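(* Let $\{n_\ell\}_{\ell\ge1}$ be a sequence satisfying the standing assumptions stated in the context, and let $f_1,f_2,f_3,f_4$ be the associated power series defined there. Let $\alpha$ be an algebraic integer with $|\alpha|>1$ such that every conjugate of $\alpha$ over $\mathbb{Q}$ other than $\alpha$ itself and its complex conjugate $\overline{\alpha}$ lies in the open unit disk $\{z:|z|<1\}$. Then the five numbers \[ 1,\quad f_1(\alpha^{-1}),\quad f_2(\alpha^{-1}),\quad f_3(\alpha^{-1}),\quad f_4(\alpha^{-1}) \] are linearly independent over the field $\mathbb{Q}(\alpha)$.
   Context: Standing assumptions: $\{n_\ell\}_{\ell\ge1}$ is a strictly increasing sequence of positive odd integers such that (i) any two distinct terms $n_i,n_j$ are coprime, and (ii) $\sum_{\ell=1}^\infty 1/n_\ell<\infty$. For a positive integer $n$, let $a_1(n)$ (resp. $a_3(n)$) be the number of terms $n_\ell$ of the sequence which divide $n$ and satisfy $n_\ell\equiv1\pmod 4$ (resp. $n_\ell\equiv 3\pmod 4$). For $j=1,2,3,4$ define $b_j(n)=a_1(n)$ if $n\equiv j\pmod 4$, $b_j(n)=a_3(n)$ if $n\equiv j+2\pmod 4$, and $b_j(n)=0$ otherwise, and set $f_j(z)=\sum_{n=1}^\infty b_j(n)z^n$, which converges for $|z|<1$. *)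

theory Defs
  imports "HOL-Analysis.Analysis" "HOL-Computational_Algebra.Computational_Algebra"
begin

text \<open>Standing assumptions on the sequence (indexed from 0 instead of 1).\<close>
definition good_seq :: "(nat \<Rightarrow> nat) \<Rightarrow> bool" where
  "good_seq n \<longleftrightarrow> strict_mono n \<and> (\<forall>l. n l > 0 \<and> odd (n l))
     \<and> (\<forall>i j. i \<noteq> j \<longrightarrow> coprime (n i) (n j))
     \<and> summable (\<lambda>l. 1 / real (n l))"

definition acount :: "(nat \<Rightarrow> nat) \<Rightarrow> nat \<Rightarrow> nat \<Rightarrow> nat" where
  "acount n r m = card {l. n l dvd m \<and> n l mod 4 = r}"

definition bcoef :: "(nat \<Rightarrow> nat) \<Rightarrow> nat \<Rightarrow> nat \<Rightarrow> nat" where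
  "bcoef n j m = (if m mod 4 = j mod 4 then acount n 1 m
                  else if m mod 4 = (j + 2) mod 4 then acount n 3 m else 0)"

definition fser :: "(nat \<Rightarrow> nat) \<Rightarrow> nat \<Rightarrow> complex \<Rightarrow> complex" where
  "fser n j z = (\<Sum>k. of_nat (bcoef n j (Suc k)) * z ^ Suc k)"

definition conjugate_over_Q :: "complex \<Rightarrow> complex \<Rightarrow> bool" where
  "conjugate_over_Q \<alpha> \<beta> \<longleftrightarrow> (\<exists>p :: rat poly. irreducible p \<and>
      poly (map_poly of_rat p) \<alpha> = 0 \<and> poly (map_poly of_rat p) \<beta> = 0)"

definition Q_adjoin :: "complex \<Rightarrow> complex set" where
  "Q_adjoin \<alpha> = {poly (map_poly of_rat p) \<alpha> / poly (map_poly of_rat q) \<alpha> | p q :: rat poly.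
      poly (map_poly of_rat q) \<alpha> \<noteq> 0}"

end

theory Submission
  imports Defs "HOL-Number_Theory.Cong"
begin

text \<open>
  After clearing denominators, a relation has coefficients in \<open>\<int>[\<alpha>]\<close>. Multiplying it by \<open>\<alpha> ^ M\<close>
  shows that the tail \<open>T M\<close> of the series beyond \<open>M\<close>, scaled by \<open>\<alpha> ^ M\<close>, is an element of \<open>\<int>[\<alpha>]\<close>. At \<open>\<alpha>\<close>
  and its complex conjugate it is governed by the coefficients just after \<open>M\<close>, and at the other conjugates, which
  lie in the unit disk, by the coefficients just before \<open>M\<close>.

  Choose \<open>L\<close> large with \<open>n L\<close> in a residue class mod 4 that occurs infinitely often. By averaging there
  is \<open>N\<close> such that no \<open>n l\<close> with \<open>l \<ge> L\<close> divides an integer near \<open>N\<close>, and \<open>N'\<close>, congruent to \<open>N\<close> modulo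
  \<open>4 * (\<Prod>l<L. n l)\<close>, such that the only exception near \<open>N'\<close> is that \<open>n L\<close> divides \<open>N'\<close> itself. For a suitable
  \<open>k\<close> all conjugates of \<open>T (N' - k) - T (N - k)\<close> and \<open>T (N' + k) - T (N + k)\<close> are tiny, since a
  perturbation at distance \<open>k\<close> is damped exponentially on either side. As \<open>\<int>[\<alpha>]\<close> is discrete under its conjugates
  both differences vanish, and the recursion for \<open>T\<close> across \<open>N'\<close> then forces the coefficient attached to
  \<open>n L\<close> to vanish. Varying \<open>N\<close> mod 4 gives all four coefficients.
\<close>

section \<open>Discreteness of the integral polynomials in an algebraic integer\<close>

abbreviation ev :: "int poly \<Rightarrow> complex \<Rightarrow> complex" where
  "ev g x \<equiv> poly (map_poly of_int g) x"

abbreviation evq :: "rat poly \<Rightarrow> complex \<Rightarrow> complex" where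
  "evq g x \<equiv> poly (map_poly of_rat g) x"

section \<open>Evaluation as a ring homomorphism\<close>

lemma map_poly_hom_add:
  assumes "h 0 = 0" "\<And>x y. h (x + y) = h x + h y"
  shows "map_poly h (p + q) = map_poly h p + map_poly h q"
  using assms by (intro poly_eqI) (simp add: coeff_map_poly)

lemma map_poly_hom_mult:
  fixes h :: "'a::comm_ring_1 \<Rightarrow> 'b::comm_ring_1"
  assumes "h 0 = 0" "\<And>x y. h (x + y) = h x + h y" "\<And>x y. h (x * y) = h x * h y"
  shows "map_poly h (p * q) = map_poly h p * map_poly h q"
proof (intro poly_eqI)
  fix k
  have sum: "h (sum f A) = (\<Sum>x\<in>A. h (f x))" for f :: "nat \<Rightarrow> 'a" and A
    by (induction A rule: infinite_finite_induct) (simp_all add: assms)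
  show "coeff (map_poly h (p * q)) k = coeff (map_poly h p * map_poly h q) k"
    by (simp add: coeff_map_poly assms coeff_mult sum)
qed

lemma ev_add [simp]: "ev (p + q) x = ev p x + ev q x"
  and ev_mult [simp]: "ev (p * q) x = ev p x * ev q x"
  by (simp_all add: map_poly_hom_add map_poly_hom_mult)

lemma evq_add [simp]: "evq (p + q) x = evq p x + evq q x"
  and evq_mult [simp]: "evq (p * q) x = evq p x * evq q x"
  by (simp_all add: map_poly_hom_add map_poly_hom_mult of_rat_add of_rat_mult)

lemma ev_0 [simp]: "ev 0 x = 0" and ev_1 [simp]: "ev 1 x = 1"
  by (simp_all add: map_poly_1)

lemma ev_minus [simp]: "ev (- p) x = - ev p x"
  using ev_add[of "p" "-p" x] by (simp add: eq_neg_iff_add_eq_0 add.commute del: ev_add)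

lemma ev_diff [simp]: "ev (p - q) x = ev p x - ev q x"
  using ev_add[of p "-q" x] by (simp del: ev_add)

lemma ev_sum: "ev (sum f A) x = (\<Sum>i\<in>A. ev (f i) x)"
  by (induction A rule: infinite_finite_induct) simp_all

lemma ev_prod: "ev (prod f A) x = (\<Prod>i\<in>A. ev (f i) x)"
  by (induction A rule: infinite_finite_induct) simp_all

lemma ev_cnj: "ev g (cnj x) = cnj (ev g x)"
proof -
  have "coeff (map_poly of_int g :: complex poly) i \<in> \<real>" for i
    by (simp add: coeff_map_poly)
  then show ?thesis
    using poly_cnj_real[of "map_poly of_int g" x] by simp
qed

lemma evq_of_int: "evq (map_poly of_int g) x = ev g x"
  by (simp add: map_poly_map_poly o_def)

text \<open>Polynomial division shows that a nonzero polynomial of least degree vanishing at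
  \<open>x\<close> divides all others. A proper factor vanishing at \<open>x\<close> would have
  smaller degree, which gives irreducibility.\<close>

lemma exists_minimal_polynomial:
  fixes p :: "rat poly" and x :: complex
  assumes "p \<noteq> 0" "evq p x = 0"
  obtains m where "irreducible m" "evq m x = 0" "\<And>g. evq g x = 0 \<Longrightarrow> m dvd g"
proof -
  define P where "P d \<longleftrightarrow> (\<exists>q. q \<noteq> 0 \<and> evq q x = 0 \<and> degree q = d)" for d
  have "P (LEAST d. P d)"
    by (rule LeastI[of P "degree p"]) (use assms in \<open>auto simp: P_def\<close>)
  then obtain m where m: "m \<noteq> 0" "evq m x = 0" "degree m = (LEAST d. P d)"
    by (auto simp: P_def)
  have min: "degree m \<le> degree q" if "q \<noteq> 0" "evq q x = 0" for q
    unfolding m(3) by (rule Least_le) (use that in \<open>auto simp: P_def\<close>)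
  have dvd: "m dvd g" if "evq g x = 0" for g
  proof (rule ccontr)
    assume "\<not> m dvd g"
    then have "g mod m \<noteq> 0" by (simp add: dvd_eq_mod_eq_0)
    moreover have "evq g x = evq m x * evq (g div m) x + evq (g mod m) x"
      by (metis mult_div_mod_eq evq_add evq_mult)
    then have "evq (g mod m) x = 0" using that m by simp
    ultimately have "degree m \<le> degree (g mod m)" by (rule min)
    with degree_mod_less'[OF m(1) \<open>g mod m \<noteq> 0\<close>] show False by simp
  qed
  have deg: "degree m > 0"
  proof (rule ccontr)
    assume "\<not> degree m > 0"
    then obtain c where "m = [:c:]" by (meson degree_0_id degree_eq_zeroE neq0_conv)
    with m show False by (auto simp: map_poly_pCons)
  qed
  have "irreducible m"
  proof (rule irreducibleI)
    show "m \<noteq> 0" "\<not> is_unit m" using m deg by (auto simp: is_unit_iff_degree)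
  next
    fix a b assume ab: "m = a * b"
    with m have nz: "a \<noteq> 0" "b \<noteq> 0" by auto
    then have d: "degree m = degree a + degree b" by (simp add: ab degree_mult_eq)
    from m ab have "evq a x = 0 \<or> evq b x = 0" by simp
    then show "a dvd 1 \<or> b dvd 1"
      using min[of a] min[of b] nz d by (auto simp: is_unit_iff_degree)
  qed
  with m dvd show ?thesis by (intro that[of m])
qed

text \<open>At a double root both \<open>m\<close> and its derivative are divisible by the minimal
  polynomial of that root. Irreducibility gives it the degree of \<open>m\<close>, while the
  derivative is nonzero of smaller degree in characteristic 0.\<close>

lemma irreducible_imp_rsquarefree_complex:
  fixes m :: "rat poly"
  assumes "irreducible m"
  shows "rsquarefree (map_poly of_rat m :: complex poly)"
  unfolding rsquarefree_roots
proof (intro allI notI, elim conjE)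
  fix x :: complex
  assume x: "evq m x = 0" "poly (pderiv (map_poly of_rat m)) x = 0"
  have m0: "m \<noteq> 0" using assms by auto
  have "pderiv (map_poly of_rat m :: complex poly) = map_poly of_rat (pderiv m)"
    by (intro poly_eqI) (simp add: coeff_pderiv coeff_map_poly of_rat_mult of_rat_add)
  with x have d: "evq (pderiv m) x = 0" by simp
  obtain q where q: "irreducible q" "evq q x = 0" "\<And>g. evq g x = 0 \<Longrightarrow> q dvd g"
    using exists_minimal_polynomial[OF m0 x(1)] by blast
  have "q dvd m" "q dvd pderiv m" using q x d by auto
  from \<open>q dvd m\<close> obtain r where r: "m = q * r" by (elim dvdE)
  with assms q have "is_unit r" using irreducibleD irreducible_not_unit by blast
  then have "degree q = degree m" using r m0 by (auto simp: degree_mult_eq is_unit_iff_degree)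
  have "degree m \<noteq> 0" using assms by (simp add: irreducible_def is_unit_iff_degree m0)
  then have "pderiv m \<noteq> 0" by (simp add: pderiv_eq_0_iff)
  with \<open>q dvd pderiv m\<close> have "degree q \<le> degree (pderiv m)" by (rule dvd_imp_degree_le)
  also have "\<dots> < degree m" using \<open>degree m \<noteq> 0\<close> by (simp add: degree_pderiv)
  finally show False using \<open>degree q = degree m\<close> by simp
qed

text \<open>Separability makes the conjugates as numerous as the degree, so that interpolation at
  them recovers every remainder modulo \<open>m\<close>.\<close>

lemma card_roots_irreducible:
  fixes m :: "rat poly"
  assumes "irreducible m"
  shows "card {x::complex. evq m x = 0} = degree m"
proof -
  let ?p = "map_poly of_rat m :: complex poly"
  have "?p = smult (lead_coeff ?p) (\<Prod>z | poly ?p z = 0. [:-z, 1:])"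
    using complex_poly_decompose_rsquarefree[OF irreducible_imp_rsquarefree_complex[OF assms]] ..
  moreover have "m \<noteq> 0" using assms by auto
  then have "?p \<noteq> 0" by (simp add: map_poly_eq_0_iff)
  ultimately have "degree ?p = degree (\<Prod>z | poly ?p z = 0. [:-z, 1:])"
    by (metis degree_smult_eq leading_coeff_0_iff)
  also have "\<dots> = card {z. poly ?p z = 0}"
    by (subst degree_prod_sum_eq) simp_all
  finally show ?thesis by (simp add: degree_map_poly)
qed

text \<open>Lagrange interpolation expresses the coefficients linearly in the values on
  \<open>R\<close>, with weights depending on \<open>R\<close> only.\<close>

lemma coeff_bound_of_values:
  fixes R :: "complex set"
  assumes "finite R"
  obtains K where "K > 0"
    "\<And>p \<epsilon> j. degree p < card R \<Longrightarrow> (\<And>z. z \<in> R \<Longrightarrow> norm (poly p z) \<le> \<epsilon>) \<Longrightarrow> \<epsilon> \<ge> 0 \<Longrightarrow> norm (coeff p j) \<le> K * \<epsilon>"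
proof -
  \<comment> \<open>Lagrange basis polynomials at the points of \<open>R\<close>\<close>
  define B where "B z = smult (1 / (\<Prod>w\<in>R-{z}. z - w)) (\<Prod>w\<in>R-{z}. [:-w, 1:])" for z
  have B_self: "poly (B z) z = 1" if "z \<in> R" for z
    using assms by (simp add: B_def poly_prod)
  have B_other: "poly (B z) w = 0" if "w \<in> R" "w \<noteq> z" for z w
    using assms that by (simp add: B_def poly_prod)
  have deg_B: "degree (B z) < card R" if "z \<in> R" for z
  proof -
    have "degree (B z) \<le> degree (\<Prod>w\<in>R-{z}. [:-w, 1:])"
      unfolding B_def by (rule degree_smult_le)
    also have "\<dots> = card (R - {z})" by (subst degree_prod_sum_eq) simp_all
    also have "\<dots> < card R" using assms that by (rule card_Diff1_less)
    finally show ?thesis .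
  qed
  define K where "K = 1 + (\<Sum>z\<in>R. \<Sum>j<card R. norm (coeff (B z) j))"
  have K: "K > 0" unfolding K_def by (intro add_pos_nonneg sum_nonneg) auto
  have "norm (coeff p j) \<le> K * \<epsilon>"
    if p: "degree p < card R" "\<And>z. z \<in> R \<Longrightarrow> norm (poly p z) \<le> \<epsilon>" "\<epsilon> \<ge> 0" for p \<epsilon> j
  proof (cases "j < card R")
    case False
    with p have "coeff p j = 0" by (intro coeff_eq_0) simp
    with K p show ?thesis by simp
  next
    case True
    define q where "q = (\<Sum>z\<in>R. smult (poly p z) (B z))"
    have "poly p w = poly q w" if "w \<in> R" for w
    proof -
      have "poly q w = (\<Sum>z\<in>R. if z = w then poly p w else 0)"
        unfolding q_def poly_sum using B_self B_other that by (intro sum.cong) auto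
      then show ?thesis using assms that by simp
    qed
    moreover have "degree q < card R"
      unfolding q_def using p(1) assms
      by (intro degree_sum_less) (auto intro: le_less_trans[OF degree_smult_le] deg_B)
    ultimately have "p = q"
      using p(1) by (intro poly_eqI_degree[of R])  auto
    then have "coeff p j = coeff q j" by simp
    also have "\<dots> = (\<Sum>z\<in>R. poly p z * coeff (B z) j)"
      by (simp add: q_def coeff_sum)
    finally have "norm (coeff p j) = norm (\<Sum>z\<in>R. poly p z * coeff (B z) j)" by simp
    also have "\<dots> \<le> (\<Sum>z\<in>R. norm (poly p z) * norm (coeff (B z) j))"
      by (intro order_trans[OF norm_sum]) (simp add: norm_mult)
    also have "\<dots> \<le> (\<Sum>z\<in>R. \<epsilon> * (\<Sum>j<card R. norm (coeff (B z) j)))"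
      using p True by (intro sum_mono mult_mono member_le_sum) auto
    also have "\<dots> \<le> K * \<epsilon>"
      using p by (simp add: K_def sum_distrib_left[symmetric] algebra_simps)
    finally show ?thesis .
  qed
  then show ?thesis by (rule that[OF K])
qed

lemma norm_of_rat_complex: "norm (of_rat q :: complex) = \<bar>of_rat q\<bar>"
proof -
  have "complex_of_real (of_rat q) = of_rat q"
    by (induction q) (simp add: of_rat_rat)
  then show ?thesis by (metis norm_of_real)
qed

lemma common_denominator:
  fixes A :: "rat set"
  assumes "finite A"
  obtains D :: int where "D > 0" "\<And>a. a \<in> A \<Longrightarrow> of_int D * a \<in> \<int>"
proof -
  have "\<exists>D::int. D > 0 \<and> (\<forall>a\<in>A. of_int D * a \<in> \<int>)"
    using assms
  proof induction
    case empty
    show ?case by (intro exI[of _ 1]) auto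
  next
    case (insert a A)
    then obtain D :: int where D: "D > 0" "\<forall>a\<in>A. of_int D * a \<in> \<int>" by blast
    obtain x y where xy: "a = of_int x / of_int y" "y > 0"
      by (metis quotient_of_div quotient_of_denom_pos surj_pair)
    have "of_int (D * y) * a = of_int (D * x)" using xy by simp
    then have "of_int (D * y) * a \<in> \<int>" by (metis Ints_of_int)
    moreover have "of_int (D * y) * b \<in> \<int>" if "b \<in> A" for b
    proof -
      have "of_int (D * y) * b = of_int y * (of_int D * b)" by simp
      then show ?thesis using D that by (metis Ints_mult Ints_of_int)
    qed
    ultimately show ?case using D xy by (intro exI[of _ "D * y"]) auto
  qed
  then show ?thesis using that by blast
qed

text \<open>Pseudo-division multiplies \<open>g\<close> by a power of the leading coefficient, which
  is 1 here; the positive degree of \<open>f\<close> covers the zero remainder.\<close>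

lemma monic_remainder_int:
  fixes f g :: "int poly"
  assumes "lead_coeff f = 1" "degree f > 0"
  obtains q r where "g = f * q + r" "degree r < degree f"
proof -
  have f0: "f \<noteq> 0" using assms by auto
  obtain q r where qr: "pseudo_divmod g f = (q, r)" by force
  from pseudo_divmod[OF f0 qr] assms have "g = f * q + r" "r = 0 \<or> degree r < degree f"
    by (auto simp: smult_1_left)
  then show ?thesis using assms by (intro that[of q r]) auto
qed

text \<open>\<open>R\<close> consists of all roots of the minimal polynomial of \<alpha>. Reduced
  modulo that polynomial, an element of Z[\<alpha>] has coefficients with a fixed common denominator
  \<open>D\<close>; interpolation at \<open>R\<close> makes them smaller than \<open>1 / D\<close>
  when all conjugates are small, so they vanish.\<close>

lemma algebraic_int_discrete:
  fixes \<alpha> :: complex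
  assumes "algebraic_int \<alpha>"
  obtains R \<delta> where "finite R" "\<And>\<beta>. \<beta> \<in> R \<Longrightarrow> conjugate_over_Q \<alpha> \<beta>" "\<delta> > 0"
    "\<And>g. (\<And>\<beta>. \<beta> \<in> R \<Longrightarrow> norm (ev g \<beta>) < \<delta>) \<Longrightarrow> ev g \<alpha> = 0"
proof -
  obtain f where f: "ev f \<alpha> = 0" "lead_coeff f = 1"
    using assms unfolding algebraic_int_altdef_ipoly by blast
  have deg_f: "degree f > 0"
  proof (rule ccontr)
    assume "\<not> degree f > 0"
    then have "f = 1" using f(2) by (metis degree_0_id gr0I one_pCons)
    with f show False by simp
  qed
  define fq where "fq = (map_poly of_int f :: rat poly)"
  have fq: "evq fq \<alpha> = 0" "fq \<noteq> 0"
    using f deg_f by (auto simp: fq_def evq_of_int map_poly_eq_0_iff)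
  obtain m where m: "irreducible m" "evq m \<alpha> = 0" "\<And>g. evq g \<alpha> = 0 \<Longrightarrow> m dvd g"
    using exists_minimal_polynomial[OF fq(2,1)] by blast
  have m0: "m \<noteq> 0" using m by auto
  define R where "R = {x::complex. evq m x = 0}"
  have fin: "finite R" unfolding R_def
    using m0 by (intro poly_roots_finite) (simp add: map_poly_eq_0_iff)
  have card_R: "card R = degree m" unfolding R_def by (rule card_roots_irreducible[OF m(1)])
  obtain K where K: "K > 0" "\<And>p \<epsilon> j. degree p < card R \<Longrightarrow>
      (\<And>z. z \<in> R \<Longrightarrow> norm (poly p z) \<le> \<epsilon>) \<Longrightarrow> \<epsilon> \<ge> 0 \<Longrightarrow> norm (coeff p j) \<le> K * \<epsilon>"
    using coeff_bound_of_values[OF fin] by metis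
  \<comment> \<open>The rational minimal polynomial is not known to be integral here, so instead of Gauss' lemma
    we use that reduction modulo \<open>m\<close> of integral polynomials of degree below \<open>degree f\<close> has
    bounded denominators.\<close>
  define X where "X i = monom 1 i mod m" for i
  obtain D :: int where D: "D > 0"
    "\<And>a. a \<in> (\<lambda>(i,j). coeff (X i) j) ` ({..<degree f} \<times> {..<degree m}) \<Longrightarrow> of_int D * a \<in> \<int>"
    by (rule common_denominator[of "(\<lambda>(i,j). coeff (X i) j) ` ({..<degree f} \<times> {..<degree m})"]) auto
  have deg_m: "degree m \<noteq> 0" using m(1) by (simp add: irreducible_def is_unit_iff_degree m0)
  have deg_mod: "degree (p mod m) < degree m" for p
    using degree_mod_less[OF m0, of p] deg_m by auto
  have D': "of_int D * coeff (X i) j \<in> \<int>" if "i < degree f" for i j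
  proof (cases "j < degree m")
    case True
    with that show ?thesis by (intro D(2)) force
  next
    case False
    then have "coeff (X i) j = 0" using deg_mod[of "monom 1 i"] by (intro coeff_eq_0) (simp add: X_def)
    then show ?thesis by simp
  qed
  \<comment> \<open>This gives \<open>K * \<delta> = 1 / (2 * D)\<close>, half the spacing of the
    values that the coefficients of a remainder can take.\<close>
  define \<delta> where "\<delta> = 1 / (2 * K * of_int D)"
  have "\<delta> > 0" using K D by (simp add: \<delta>_def)
  have discrete: "ev g \<alpha> = 0" if small: "\<And>\<beta>. \<beta> \<in> R \<Longrightarrow> norm (ev g \<beta>) < \<delta>" for g
  proof -
    \<comment> \<open>The monic \<open>f\<close> vanishes on all of \<open>R\<close>, so the
      remainder has the same conjugates as \<open>g\<close> and a degree bounded independently of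
      \<open>g\<close>; finitely many \<open>X i\<close> then describe every case.\<close>
    obtain q r where qr: "g = f * q + r" "degree r < degree f"
      using monic_remainder_int[OF f(2) deg_f] by blast
    define h where "h = (map_poly of_int r :: rat poly) mod m"
    have ev_r: "ev r \<beta> = evq h \<beta>" if "\<beta> \<in> R" for \<beta>
    proof -
      have "ev r \<beta> = evq (map_poly of_int r) \<beta>" by (simp add: evq_of_int)
      also have "\<dots> = evq (m * (map_poly of_int r div m) + h) \<beta>" unfolding h_def by simp
      also have "\<dots> = evq h \<beta>" using that by (simp add: R_def)
      finally show ?thesis .
    qed
    have ev_g: "ev g \<beta> = evq h \<beta>" if "\<beta> \<in> R" for \<beta>
    proof -
      have "m dvd fq" using m(3) fq by blast
      then obtain s where "fq = m * s" by (elim dvdE)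
      then have "evq fq \<beta> = 0" using that by (simp add: R_def)
      then have "ev f \<beta> = 0" by (simp add: fq_def evq_of_int)
      then show ?thesis using ev_r[OF that] by (simp add: qr)
    qed
    have h_sum: "h = (\<Sum>i<degree f. smult (of_int (coeff r i)) (X i))"
    proof -
      have "map_poly of_int r = (\<Sum>i<degree f. smult (of_int (coeff r i)) (monom (1::rat) i))"
        using qr(2)
        by (intro poly_eqI) (auto simp: coeff_sum coeff_map_poly if_distrib cong: if_cong intro: coeff_eq_0)
      moreover have "(\<Sum>i\<in>A. smult (c i) (p i)) mod m = (\<Sum>i\<in>A. smult (c i) (p i mod m))"
        for A and c :: "nat \<Rightarrow> rat" and p
        by (induction A rule: infinite_finite_induct) (simp_all add: poly_mod_add_left mod_smult_left)
      ultimately show ?thesis by (simp add: h_def X_def)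
    qed
    have int: "of_int D * coeff h j \<in> \<int>" for j
    proof -
      have "of_int D * coeff h j = (\<Sum>i<degree f. of_int (coeff r i) * (of_int D * coeff (X i) j))"
        by (simp add: h_sum coeff_sum sum_distrib_left algebra_simps)
      also have "\<dots> \<in> \<int>"
        by (intro Ints_sum Ints_mult[OF Ints_of_int D']) simp
      finally show ?thesis .
    qed
    have "coeff h j = 0" for j
    proof -
      have "norm (coeff (map_poly of_rat h :: complex poly) j) \<le> K * \<delta>"
      proof (rule K(2))
        show "degree (map_poly of_rat h :: complex poly) < card R"
          using deg_mod by (simp add: card_R h_def degree_map_poly)
        show "norm (evq h z) \<le> \<delta>" if "z \<in> R" for z using small[OF that] ev_g[OF that] by simp
      qed (use \<open>\<delta> > 0\<close> in simp)
      also have "\<dots> = 1 / (2 * of_int D)" using K by (simp add: \<delta>_def)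
      finally have a: "\<bar>real_of_rat (coeff h j)\<bar> \<le> 1 / (2 * of_int D)"
        by (simp add: coeff_map_poly norm_of_rat_complex)
      obtain z where z: "of_int D * coeff h j = of_int z" using int[of j] by (rule Ints_cases)
      have "real_of_int z = of_rat (of_int D * coeff h j)" by (simp add: z)
      also have "\<dots> = of_int D * of_rat (coeff h j)" by (simp add: of_rat_mult)
      finally have "\<bar>real_of_int z\<bar> = of_int D * \<bar>real_of_rat (coeff h j)\<bar>" using D by (simp add: abs_mult)
      also have "\<dots> \<le> of_int D * (1 / (2 * of_int D))" using a D by (intro mult_left_mono) auto
      also have "\<dots> < 1" using D by simp
      finally have "z = 0" by simp
      with z D show ?thesis by simp
    qed
    then have "h = 0" by (intro poly_eqI) simp
    moreover have "\<alpha> \<in> R" using m by (simp add: R_def)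
    ultimately show ?thesis using ev_g by simp
  qed
  have "conjugate_over_Q \<alpha> \<beta>" if "\<beta> \<in> R" for \<beta>
    using that m by (auto simp: conjugate_over_Q_def R_def)
  then show ?thesis by (rule that[OF fin _ \<open>\<delta> > 0\<close> discrete])
qed

section \<open>Positions with few divisors nearby\<close>

text \<open>The distance of \<open>m\<close> and \<open>M\<close>: truncation makes one summand
  0.\<close>

definition gap :: "nat \<Rightarrow> nat \<Rightarrow> nat" where
  "gap m M = (m - M) + (M - m)"

text \<open>A count centred at \<open>M\<close> and damped exponentially on both sides. For
  nonnegative integral \<open>a\<close> a small value means that \<open>a\<close> vanishes on a long
  stretch around \<open>M\<close>.\<close>

definition wsum :: "real \<Rightarrow> (nat \<Rightarrow> real) \<Rightarrow> nat \<Rightarrow> real" where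
  "wsum \<theta> a M = (\<Sum>m. a m * \<theta> ^ gap m M)"

text \<open>The value at \<open>0\<close>, which every term of the sequence divides, is set to \<open>0\<close>.\<close>

definition divcount :: "(nat \<Rightarrow> nat) \<Rightarrow> nat set \<Rightarrow> nat \<Rightarrow> real" where
  "divcount n F m = (if m = 0 then 0 else real (card {l \<in> F. n l dvd m}))"

lemma gap_triangle: "gap a c \<le> gap a b + gap b c"
  by (simp add: gap_def)

lemma summable_linear_power:
  fixes \<theta> c :: real
  assumes "0 < \<theta>" "\<theta> < 1"
  shows "summable (\<lambda>i. (real i + c) * \<theta> ^ i)"
proof -
  have "summable (\<lambda>i. of_nat (Suc i) * \<theta> ^ i + (c - 1) * \<theta> ^ i)"
    using geometric_deriv_sums[of \<theta>] assms
    by (intro summable_add summable_mult summable_geometric) (auto simp: sums_iff)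
  then show ?thesis by (simp add: algebra_simps)
qed

lemma summable_gap:
  fixes \<theta> :: real
  assumes "0 < \<theta>" "\<theta> < 1" "\<And>m. 0 \<le> a m" "\<And>m. a m \<le> real m + 1"
  shows "summable (\<lambda>m. a m * \<theta> ^ gap m M)"
proof -
  have "summable (\<lambda>i. a (i + M) * \<theta> ^ i)"
  proof (rule summable_comparison_test'[OF summable_linear_power[OF assms(1,2), of "real M + 1"]])
    fix i
    show "norm (a (i + M) * \<theta> ^ i) \<le> (real i + (real M + 1)) * \<theta> ^ i"
      using assms(1) assms(3,4)[of "i + M"] by (simp add: abs_mult mult_right_mono)
  qed
  then show ?thesis
    using summable_iff_shift[of "\<lambda>m. a m * \<theta> ^ gap m M" M] by (simp add: gap_def)
qed

lemma term_le_wsum: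
  assumes "0 < \<theta>" "\<theta> < 1" "\<And>m. 0 \<le> a m" "\<And>m. a m \<le> real m + 1"
  shows "a m * \<theta> ^ gap m M \<le> wsum \<theta> a M"
  using sum_le_suminf[OF summable_gap[OF assms, of M], of "{m}"] assms
  by (simp add: wsum_def)

text \<open>By the triangle inequality, moving the centre costs at most a factor
  \<open>1 / \<theta>\<close> per unit of distance.\<close>

lemma wsum_shift_le:
  assumes "0 < \<theta>" "\<theta> < 1" "\<And>m. 0 \<le> a m" "\<And>m. a m \<le> real m + 1"
  shows "wsum \<theta> a M \<le> wsum \<theta> a N / \<theta> ^ gap M N"
proof -
  have "a m * \<theta> ^ gap m M \<le> a m * \<theta> ^ gap m N / \<theta> ^ gap M N" for m
  proof -
    have "\<theta> ^ gap m M * \<theta> ^ gap M N \<le> \<theta> ^ gap m N"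
      using assms power_decreasing[OF gap_triangle[of m N M], of \<theta>] by (simp add: power_add)
    then show ?thesis
      using assms by (simp add: field_simps mult_left_mono)
  qed
  then have "wsum \<theta> a M \<le> (\<Sum>m. a m * \<theta> ^ gap m N / \<theta> ^ gap M N)"
    unfolding wsum_def by (intro suminf_le summable_divide summable_gap assms)
  also have "\<dots> = wsum \<theta> a N / \<theta> ^ gap M N"
    unfolding wsum_def by (intro suminf_divide summable_gap assms)
  finally show ?thesis .
qed

text \<open>Indexing by the distance \<open>i\<close> prepares the averaging over \<open>N\<close>.
  The right side may exceed \<open>wsum\<close>, as it counts the centre twice and, by truncation,
  repeats \<open>a 0\<close> whenever \<open>i > N\<close>.\<close>

lemma wsum_le_two_sided:
  assumes "0 < \<theta>" "\<theta> < 1" "\<And>m. 0 \<le> a m" "\<And>m. a m \<le> real m + 1"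
  shows "summable (\<lambda>i. (a (N + i) + a (N - i)) * \<theta> ^ i)"
    "wsum \<theta> a N \<le> (\<Sum>i. (a (N + i) + a (N - i)) * \<theta> ^ i)"
proof -
  have s1: "summable (\<lambda>i. a (N + i) * \<theta> ^ i)"
    using summable_iff_shift[of "\<lambda>m. a m * \<theta> ^ gap m N" N] summable_gap[OF assms, of N]
    by (simp add: gap_def add.commute)
  have s2: "summable (\<lambda>i. a (N - i) * \<theta> ^ i)"
  proof (rule summable_comparison_test'[OF summable_linear_power[OF assms(1,2), of "real N + 1"]])
    fix i
    have "a (N - i) \<le> real i + (real N + 1)" using assms(4)[of "N - i"] by linarith
    then show "norm (a (N - i) * \<theta> ^ i) \<le> (real i + (real N + 1)) * \<theta> ^ i"
      using assms(1,3) by (simp add: abs_mult mult_right_mono)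
  qed
  show s: "summable (\<lambda>i. (a (N + i) + a (N - i)) * \<theta> ^ i)"
    using summable_add[OF s1 s2] by (simp add: algebra_simps)
  have "wsum \<theta> a N = (\<Sum>i. a (N + i) * \<theta> ^ i) + (\<Sum>m<N. a m * \<theta> ^ (N - m))"
    unfolding wsum_def
    by (subst suminf_split_initial_segment[OF summable_gap[OF assms], where k = N])
       (simp add: gap_def add.commute)
  also have "(\<Sum>m<N. a m * \<theta> ^ (N - m)) = (\<Sum>i\<in>{1..N}. a (N - i) * \<theta> ^ i)"
    by (rule sum.reindex_bij_witness[of _ "\<lambda>i. N - i" "\<lambda>i. N - i"]) auto
  also have "\<dots> \<le> (\<Sum>i. a (N - i) * \<theta> ^ i)"
    using assms by (intro sum_le_suminf s2) auto
  also have "(\<Sum>i. a (N + i) * \<theta> ^ i) + (\<Sum>i. a (N - i) * \<theta> ^ i)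
      = (\<Sum>i. (a (N + i) + a (N - i)) * \<theta> ^ i)"
    by (subst suminf_add[OF s1 s2]) (simp add: algebra_simps)
  finally show "wsum \<theta> a N \<le> (\<Sum>i. (a (N + i) + a (N - i)) * \<theta> ^ i)" by simp
qed

section \<open>Divisor counts and the density of the sequence\<close>

lemma good_seq_ge: "good_seq n \<Longrightarrow> l \<le> n l"
  unfolding good_seq_def using seq_suble by blast

lemma finite_le_good_seq: "good_seq n \<Longrightarrow> finite {l. n l \<le> Y}"
  by (rule finite_subset[of _ "{..Y}"]) (auto dest: good_seq_ge intro: order_trans)

lemma finite_dvd_good_seq: "good_seq n \<Longrightarrow> m > 0 \<Longrightarrow> finite {l. n l dvd m}"
  by (rule finite_subset[OF _ finite_le_good_seq[of n m]]) (auto dest: dvd_imp_le)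

lemma divcount_nonneg: "0 \<le> divcount n F m"
  by (simp add: divcount_def)

lemma divcount_le:
  assumes "good_seq n"
  shows "divcount n F m \<le> real m + 1"
proof (cases "m = 0")
  case False
  have "{l \<in> F. n l dvd m} \<subseteq> {..m}"
    using good_seq_ge[OF assms] False by (auto dest!: dvd_imp_le intro: order_trans)
  then have "card {l \<in> F. n l dvd m} \<le> card {..m}" by (intro card_mono) auto
  with False show ?thesis by (simp add: divcount_def)
qed (simp add: divcount_def)

lemma card_congruent_le:
  assumes "T \<subseteq> {..<X}" "q > 0" "\<And>t t'. t \<in> T \<Longrightarrow> t' \<in> T \<Longrightarrow> [t = t'] (mod q)"
  shows "real (card T) \<le> real X / real q + 1"
proof -
  have "inj_on (\<lambda>t. t div q) T"
    using assms(3) by (intro inj_onI) (metis cong_def div_mult_mod_eq)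
  moreover have "(\<lambda>t. t div q) ` T \<subseteq> {..X div q}"
    using assms(1) by (auto intro!: div_le_mono)
  ultimately have "card T \<le> card {..X div q}" by (intro card_inj_on_le) auto
  then have "real (card T) \<le> real (X div q) + 1" by simp
  also have "\<dots> \<le> real X / real q + 1" by (simp add: of_nat_div_le_of_nat)
  finally show ?thesis .
qed

text \<open>Convergence of the reciprocal sum forces density zero: past \<open>L\<close> each term
  up to \<open>Y\<close> contributes at least \<open>1 / Y\<close> to a tail below
  \<open>\<eta>\<close>, and the first \<open>L\<close> indices go into \<open>C\<close>.\<close>

lemma good_seq_sparse:
  assumes "good_seq n" "\<eta> > 0"
  obtains C :: real where "C \<ge> 0" "\<And>Y. real (card {l. n l \<le> Y}) \<le> \<eta> * real Y + C"
proof -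
  have s: "summable (\<lambda>l. 1 / real (n l))" and pos: "\<And>l. n l > 0"
    using assms by (auto simp: good_seq_def)
  obtain L where L: "\<And>m. m \<ge> L \<Longrightarrow> norm (\<Sum>i. 1 / real (n (i + m))) < \<eta>"
    using suminf_exist_split[OF assms(2) s] by blast
  have s': "summable (\<lambda>i. 1 / real (n (i + L)))" using s by (rule summable_ignore_initial_segment)
  have "real (card {l. n l \<le> Y}) \<le> \<eta> * real Y + real L" for Y
  proof -
    define B where "B = {i. n (i + L) \<le> Y}"
    have finB: "finite B"
      unfolding B_def
      using finite_vimageI[OF finite_le_good_seq[OF assms(1), of Y], of "\<lambda>i. i + L"]
      by (simp add: vimage_def)
    have "{l. n l \<le> Y} \<subseteq> {..<L} \<union> (\<lambda>i. i + L) ` B"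
    proof
      fix l assume l: "l \<in> {l. n l \<le> Y}"
      show "l \<in> {..<L} \<union> (\<lambda>i. i + L) ` B"
      proof (cases "l < L")
        case False
        then have "l = (l - L) + L" "l - L \<in> B" using l by (auto simp: B_def)
        then show ?thesis by blast
      qed simp
    qed
    then have "card {l. n l \<le> Y} \<le> card ({..<L} \<union> (\<lambda>i. i + L) ` B)"
      using finB by (intro card_mono) auto
    also have "\<dots> \<le> card {..<L} + card ((\<lambda>i. i + L) ` B)" by (rule card_Un_le)
    also have "\<dots> \<le> L + card B" using finB by (simp add: card_image_le)
    finally have "real (card {l. n l \<le> Y}) \<le> real L + real (card B)" by linarith
    also have "real (card B) = (\<Sum>i\<in>B. 1)" by simp
    also have "\<dots> \<le> (\<Sum>i\<in>B. real Y * (1 / real (n (i + L))))"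
      using pos by (intro sum_mono) (auto simp: B_def field_simps)
    also have "\<dots> = real Y * (\<Sum>i\<in>B. 1 / real (n (i + L)))" by (simp add: sum_distrib_left)
    also have "\<dots> \<le> real Y * (\<Sum>i. 1 / real (n (i + L)))"
      by (intro mult_left_mono sum_le_suminf s' finB) auto
    also have "\<dots> \<le> real Y * \<eta>" using L[of L] by (intro mult_left_mono) auto
    finally show ?thesis by (simp add: mult.commute)
  qed
  then show ?thesis by (intro that[of "real L"]) auto
qed

text \<open>Exchanging the sums, each \<open>n l\<close> divides a positive \<open>s t\<close> for
  at most one residue class of \<open>t\<close>, hence at most \<open>X / n l + 1\<close> times;
  only indices with \<open>n l \<le> Y\<close> occur. In the use below \<open>s\<close> runs through
  a shifted arithmetic progression.\<close>

lemma sum_divcount_le: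
  assumes n: "good_seq n"
    and le: "\<And>t. t < X \<Longrightarrow> s t \<le> Y"
    and cong: "\<And>l t t'. l \<in> F \<Longrightarrow> 0 < s t \<Longrightarrow> 0 < s t' \<Longrightarrow> n l dvd s t \<Longrightarrow> n l dvd s t' \<Longrightarrow> [t = t'] (mod n l)"
  shows "(\<Sum>t<X. divcount n F (s t))
    \<le> real X * (\<Sum>l. if l \<in> F then 1 / real (n l) else 0) + real (card {l. n l \<le> Y})"
proof -
  have s: "summable (\<lambda>l. 1 / real (n l))" and pos: "\<And>l. n l > 0"
    using n by (auto simp: good_seq_def)
  have s': "summable (\<lambda>l. if l \<in> F then 1 / real (n l) else 0)"
    by (rule summable_comparison_test'[OF s]) simp
  define A where "A = {l \<in> F. n l \<le> Y}"
  have finA: "finite A" unfolding A_def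
    by (rule finite_subset[OF _ finite_le_good_seq[OF n, of Y]]) auto
  define P where "P t l \<longleftrightarrow> 0 < s t \<and> n l dvd s t" for t l
  have "divcount n F (s t) = (\<Sum>l\<in>A. if P t l then 1 else 0)" if "t < X" for t
  proof (cases "s t = 0")
    case False
    have "{l \<in> F. n l dvd s t} = {l \<in> A. P t l}"
      using False le[OF that] by (auto simp: A_def P_def dest: dvd_imp_le)
    then show ?thesis using False finA by (simp add: divcount_def sum.If_cases Int_def)
  qed (simp add: divcount_def P_def)
  then have "(\<Sum>t<X. divcount n F (s t)) = (\<Sum>t<X. \<Sum>l\<in>A. if P t l then 1 else 0)"
    by simp
  also have "\<dots> = (\<Sum>l\<in>A. \<Sum>t<X. if P t l then 1 else 0)" by (rule sum.swap)
  also have "\<dots> = (\<Sum>l\<in>A. real (card {t. t < X \<and> P t l}))"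
    by (simp add: sum.If_cases Int_def)
  also have "\<dots> \<le> (\<Sum>l\<in>A. real X / real (n l) + 1)"
    using pos cong by (intro sum_mono card_congruent_le) (auto simp: P_def A_def)
  also have "\<dots> = real X * (\<Sum>l\<in>A. if l \<in> F then 1 / real (n l) else 0) + real (card A)"
    by (simp add: sum.distrib sum_distrib_left A_def)
  also have "\<dots> \<le> real X * (\<Sum>l. if l \<in> F then 1 / real (n l) else 0) + real (card {l. n l \<le> Y})"
    by (intro add_mono mult_left_mono sum_le_suminf s' finA of_nat_mono card_mono finite_le_good_seq n)
       (auto simp: A_def)
  finally show ?thesis .
qed

text \<open>Averaging over \<open>N = N0 + Q t\<close>, \<open>t < X\<close>: by coprimality \<open>n l\<close> divides at most
  \<open>X / n l + 1\<close> of the shifted values, and the terms \<open>+ 1\<close> contribute \<open>o(X)\<close> because the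
  sequence has density zero.\<close>

lemma exists_small_wsum:
  assumes n: "good_seq n" and \<theta>: "0 < \<theta>" "\<theta> < 1" and Q: "Q > 0"
    and cop: "\<And>l. l \<in> F \<Longrightarrow> coprime Q (n l)"
    and small: "2 * (\<Sum>l. if l \<in> F then 1 / real (n l) else 0) / (1 - \<theta>) < \<epsilon>"
  obtains N where "N \<ge> N0" "[N = N0] (mod Q)" "wsum \<theta> (divcount n F) N < \<epsilon>"
proof (rule ccontr)
  assume "\<not> thesis"
  with that have no: "\<epsilon> \<le> wsum \<theta> (divcount n F) N" if "N \<ge> N0" "[N = N0] (mod Q)" for N
    using that by force
  define \<tau> where "\<tau> = (\<Sum>l. if l \<in> F then 1 / real (n l) else 0)"
  define d where "d = divcount n F"
  have d: "0 \<le> d m" "d m \<le> real m + 1" for m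
    using divcount_nonneg divcount_le[OF n] by (auto simp: d_def)
  \<comment> \<open>Chosen so that the error \<open>2 * \<eta> * Q / (1 - \<theta>)\<close> is half
    the slack in \<open>small\<close>; this leaves the bound \<open>\<kappa>\<close> for the average
    strictly below \<open>\<epsilon>\<close>.\<close>
  define \<eta> where "\<eta> = (\<epsilon> - 2 * \<tau> / (1 - \<theta>)) * (1 - \<theta>) / (4 * real Q)"
  have \<eta>: "\<eta> > 0" using small \<theta> Q by (simp add: \<eta>_def \<tau>_def)
  obtain C where C: "C \<ge> 0" "\<And>Y. real (card {l. n l \<le> Y}) \<le> \<eta> * real Y + C"
    using good_seq_sparse[OF n \<eta>] by blast
  define \<kappa> where "\<kappa> = 2 * (\<tau> + \<eta> * real Q) / (1 - \<theta>)"
  have "2 * (x * u / (4 * q)) * q / u = x / 2" if "u \<noteq> 0" "q \<noteq> 0" for x u q :: real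
    using that by (simp add: field_simps)
  then have "2 * \<eta> * real Q / (1 - \<theta>) = (\<epsilon> - 2 * \<tau> / (1 - \<theta>)) / 2"
    unfolding \<eta>_def by this (use Q \<theta> in auto)
  then have "\<kappa> = 2 * \<tau> / (1 - \<theta>) + (\<epsilon> - 2 * \<tau> / (1 - \<theta>)) / 2"
    by (simp add: \<kappa>_def add_divide_distrib distrib_left mult.assoc)
  then have \<kappa>: "\<kappa> < \<epsilon>" using small by (simp add: \<tau>_def field_simps)
  \<comment> \<open>\<open>K0\<close> collects everything that does not grow with
    \<open>X\<close>.\<close>
  define K0 where "K0 = (\<Sum>i. 2 * ((\<eta> * (real N0 + real i) + C) * \<theta> ^ i))"
  have sum1: "summable (\<lambda>i. 2 * ((\<eta> * (real N0 + real i) + C) * \<theta> ^ i))"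
  proof -
    have "summable (\<lambda>i. 2 * (\<eta> * ((real i + (real N0 + C / \<eta>)) * \<theta> ^ i)))"
      by (intro summable_mult summable_linear_power \<theta>)
    moreover have "\<eta> * ((real i + (real N0 + C / \<eta>)) * \<theta> ^ i) = (\<eta> * (real N0 + real i) + C) * \<theta> ^ i" for i
      using \<eta> by (simp add: field_simps)
    ultimately show ?thesis by simp
  qed
  have bound: "real X * \<epsilon> \<le> real X * \<kappa> + K0" for X
  proof -
    define S where "S t = N0 + Q * t" for t
    have one: "(\<Sum>t<X. d (S t + i)) \<le> real X * \<tau> + (\<eta> * (real N0 + real Q * real X + real i) + C)" for i
    proof -
      have "(\<Sum>t<X. d (S t + i)) \<le> real X * \<tau> + real (card {l. n l \<le> N0 + Q * X + i})"
        unfolding d_def \<tau>_def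
      proof (rule sum_divcount_le[OF n])
        fix l t t' assume l: "l \<in> F" and "n l dvd S t + i" "n l dvd S t' + i"
        then have "[S t + i = S t' + i] (mod n l)" by (simp add: cong_def)
        then have "[Q * t = Q * t'] (mod n l)"
          by (simp add: S_def cong_add_rcancel_nat cong_add_lcancel_nat)
        then show "[t = t'] (mod n l)" using cop[OF l] by (simp add: cong_mult_lcancel_nat)
      qed (simp add: S_def)
      also have "\<dots> \<le> real X * \<tau> + (\<eta> * real (N0 + Q * X + i) + C)" using C(2)[of "N0 + Q * X + i"] by simp
      finally show ?thesis by simp
    qed
    have two: "(\<Sum>t<X. d (S t - i)) \<le> real X * \<tau> + (\<eta> * (real N0 + real Q * real X + real i) + C)" for i
    proof -
      have "(\<Sum>t<X. d (S t - i)) \<le> real X * \<tau> + real (card {l. n l \<le> N0 + Q * X + i})"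
        unfolding d_def \<tau>_def
      proof (rule sum_divcount_le[OF n])
        show "S t - i \<le> N0 + Q * X + i" if "t < X" for t
        proof -
          have "Q * t \<le> Q * X" using that by simp
          then show ?thesis unfolding S_def by linarith
        qed
      next
        fix l t t' assume l: "l \<in> F" and g: "0 < S t - i" "0 < S t' - i" and "n l dvd S t - i" "n l dvd S t' - i"
        \<comment> \<open>Positivity excludes truncation, so adding \<open>i\<close> recovers
          \<open>S t\<close>; truncated values are 0 and count nothing.\<close>
        then have "[(S t - i) + i = (S t' - i) + i] (mod n l)"
          by (intro cong_add) (auto simp: cong_def)
        moreover have "(S t - i) + i = S t" "(S t' - i) + i = S t'" using g by simp_all
        ultimately have "[S t = S t'] (mod n l)" by (simp only:)
        then have "[Q * t = Q * t'] (mod n l)"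
          by (simp add: S_def cong_add_rcancel_nat cong_add_lcancel_nat)
        then show "[t = t'] (mod n l)" using cop[OF l] by (simp add: cong_mult_lcancel_nat)
      qed
      also have "\<dots> \<le> real X * \<tau> + (\<eta> * real (N0 + Q * X + i) + C)" using C(2)[of "N0 + Q * X + i"] by simp
      finally show ?thesis by simp
    qed
    define c where "c = 2 * (real X * (\<tau> + \<eta> * real Q))"
    have "real X * \<epsilon> = (\<Sum>t<X. \<epsilon>)" by simp
    also have "\<dots> \<le> (\<Sum>t<X. wsum \<theta> d (S t))"
      unfolding d_def by (intro sum_mono no) (auto simp: S_def cong_def)
    also have "\<dots> \<le> (\<Sum>t<X. \<Sum>i. (d (S t + i) + d (S t - i)) * \<theta> ^ i)"
      by (intro sum_mono wsum_le_two_sided \<theta> d)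
    also have "\<dots> = (\<Sum>i. \<Sum>t<X. (d (S t + i) + d (S t - i)) * \<theta> ^ i)"
      by (intro suminf_sum[symmetric] wsum_le_two_sided \<theta> d)
    also have "\<dots> \<le> (\<Sum>i. c * \<theta> ^ i + 2 * ((\<eta> * (real N0 + real i) + C) * \<theta> ^ i))"
    proof (rule suminf_le)
      fix i
      have "(\<Sum>t<X. (d (S t + i) + d (S t - i)) * \<theta> ^ i)
          = ((\<Sum>t<X. d (S t + i)) + (\<Sum>t<X. d (S t - i))) * \<theta> ^ i"
        by (simp add: sum.distrib sum_distrib_right distrib_right)
      also have "\<dots> \<le> (c + 2 * (\<eta> * (real N0 + real i) + C)) * \<theta> ^ i"
        using one[of i] two[of i] \<theta> by (intro mult_right_mono) (auto simp: c_def algebra_simps)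
      finally show "(\<Sum>t<X. (d (S t + i) + d (S t - i)) * \<theta> ^ i)
          \<le> c * \<theta> ^ i + 2 * ((\<eta> * (real N0 + real i) + C) * \<theta> ^ i)"
        by (simp add: algebra_simps)
    next
      show "summable (\<lambda>i. \<Sum>t<X. (d (S t + i) + d (S t - i)) * \<theta> ^ i)"
        by (intro summable_sum wsum_le_two_sided \<theta> d)
      show "summable (\<lambda>i. c * \<theta> ^ i + 2 * ((\<eta> * (real N0 + real i) + C) * \<theta> ^ i))"
        using \<theta> by (intro summable_add sum1 summable_mult summable_geometric) simp
    qed
    also have "\<dots> = (\<Sum>i. c * \<theta> ^ i) + K0"
      unfolding K0_def using \<theta> by (intro suminf_add[symmetric] sum1 summable_mult summable_geometric) simp
    also have "(\<Sum>i. c * \<theta> ^ i) = c / (1 - \<theta>)"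
      using \<theta> by (subst suminf_mult) (auto intro: summable_geometric simp: suminf_geometric)
    also have "\<dots> = real X * \<kappa>" by (simp add: c_def \<kappa>_def)
    finally show ?thesis .
  qed
  obtain X :: nat where X: "real X > K0 / (\<epsilon> - \<kappa>)" using reals_Archimedean2 by blast
  then have "K0 < real X * (\<epsilon> - \<kappa>)" using \<kappa> by (simp add: field_simps)
  with bound[of X] show False by (simp add: algebra_simps)
qed

section \<open>Tails of the series\<close>

lemma ev_monom [simp]: "ev (monom 1 k) x = x ^ k"
  by (simp add: map_poly_monom poly_monom)

lemma good_seq_mod_4: "good_seq n \<Longrightarrow> n l mod 4 = 1 \<or> n l mod 4 = 3"
proof -
  assume "good_seq n"
  then have "odd (n l)" by (simp add: good_seq_def)
  then show ?thesis by presburger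
qed

text \<open>A linear combination of \<open>b\<^sub>1, \<dots>, b\<^sub>4\<close> with coefficients \<open>g 1, \<dots>, g 4\<close> is, at \<open>m\<close>, the sum
  over all \<open>l\<close> with \<open>n l dvd m\<close> of the single coefficient \<open>ucoef g (n l mod 4) m\<close>; \<open>bsum\<close> restricts
  this sum to \<open>l \<in> F\<close>.\<close>

definition idx :: "nat \<Rightarrow> nat" where
  "idx r = (if r mod 4 = 0 then 4 else r mod 4)"

definition ucoef :: "(nat \<Rightarrow> 'a) \<Rightarrow> nat \<Rightarrow> nat \<Rightarrow> 'a" where
  "ucoef g c m = g (idx (if c = 1 then m else m + 2))"

definition bsum :: "(nat \<Rightarrow> nat) \<Rightarrow> (nat \<Rightarrow> 'a::comm_monoid_add) \<Rightarrow> nat set \<Rightarrow> nat \<Rightarrow> 'a" where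
  "bsum n g F m = (if m = 0 then 0 else (\<Sum>l | l \<in> F \<and> n l dvd m. ucoef g (n l mod 4) m))"

text \<open>If \<open>g 0 + \<Sum>\<^sub>j g j * f\<^sub>j (1 / \<alpha>) = 0\<close> at \<open>\<alpha>\<close>, the value of this integral polynomial at \<open>\<alpha>\<close> is the
  tail of the series beyond index \<open>M\<close>, scaled by \<open>\<alpha> ^ M\<close>; its values at the other conjugates involve
  only the indices up to \<open>M\<close>.\<close>

definition tailpoly :: "(nat \<Rightarrow> nat) \<Rightarrow> (nat \<Rightarrow> int poly) \<Rightarrow> nat \<Rightarrow> int poly" where
  "tailpoly n g M = - (g 0 * monom 1 M + (\<Sum>i<M. bsum n g UNIV (M - i) * monom 1 i))"

lemma idx_in: "idx r \<in> {1..4}"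
proof -
  have "r mod 4 < 4" by simp
  then show ?thesis unfolding idx_def by auto
qed

lemma idx_mod: "j \<in> {1..4} \<Longrightarrow> r mod 4 = j mod 4 \<Longrightarrow> idx r = j"
  unfolding idx_def by (cases "j = 4") auto

lemma ucoef_cong:
  assumes "m mod 4 = m' mod 4"
  shows "ucoef g c m = ucoef g c m'"
proof -
  have "(m + 2) mod 4 = (m' + 2) mod 4" by (rule mod_add_cong[OF assms refl])
  then have "idx (m + 2) = idx (m' + 2)" "idx m = idx m'" unfolding idx_def using assms by simp_all
  then show ?thesis unfolding ucoef_def by simp
qed

lemma ev_bsum: "ev (bsum n g F m) x = bsum n (\<lambda>j. ev (g j) x) F m"
  by (simp add: bsum_def ev_sum ucoef_def)

text \<open>Each divisor \<open>n l\<close> of \<open>m\<close> enters exactly one of the four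
  coefficients: the one with \<open>j\<close> congruent to \<open>m\<close> modulo 4 if
  \<open>n l\<close> is 1 modulo 4, and to \<open>m + 2\<close> if it is 3.\<close>

lemma sum_bcoef_eq_bsum:
  fixes c :: "nat \<Rightarrow> complex"
  assumes n: "good_seq n" and "m > 0"
  shows "(\<Sum>j=1..4. c j * of_nat (bcoef n j m)) = bsum n c UNIV m"
proof -
  define A where "A = {l. n l dvd m}"
  have finA: "finite A" unfolding A_def by (rule finite_dvd_good_seq[OF assms])
  have ac: "acount n r m = (\<Sum>l\<in>A. if n l mod 4 = r then 1 else 0)" for r
    using finA by (simp add: acount_def sum.If_cases A_def Int_def)
  define w where "w j l = (if m mod 4 = j mod 4 then if n l mod 4 = 1 then 1 else 0
      else if m mod 4 = (j + 2) mod 4 then if n l mod 4 = 3 then 1 else 0 else (0::complex))" for j l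
  have "of_nat (bcoef n j m) = (\<Sum>l\<in>A. w j l)" for j
    by (simp add: bcoef_def ac w_def of_nat_sum if_distrib[of of_nat] cong: if_cong)
  then have "(\<Sum>j=1..4. c j * of_nat (bcoef n j m)) = (\<Sum>j=1..4. \<Sum>l\<in>A. c j * w j l)"
    by (simp add: sum_distrib_left)
  also have "\<dots> = (\<Sum>l\<in>A. \<Sum>j=1..4. c j * w j l)" by (rule sum.swap)
  also have "\<dots> = (\<Sum>l\<in>A. ucoef c (n l mod 4) m)"
  proof (rule sum.cong[OF refl])
    fix l
    have "{1..4::nat} = {1, 2, 3, 4}" by auto
    then have four: "(\<Sum>j=1..4. f j) = f 1 + f 2 + f 3 + f 4" for f :: "nat \<Rightarrow> complex" by simp
    have ix: "idx m = (if m mod 4 = 0 then 4 else m mod 4)"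
      "idx (m + 2) = (if (m mod 4 + 2) mod 4 = 0 then 4 else (m mod 4 + 2) mod 4)"
      unfolding idx_def by (simp, metis mod_add_left_eq)
    have u: "ucoef c (n l mod 4) m = (if n l mod 4 = 1 then c (idx m) else c (idx (m + 2)))"
      by (simp add: ucoef_def)
    have "m mod 4 < 4" by simp
    then consider "m mod 4 = 0" | "m mod 4 = 1" | "m mod 4 = 2" | "m mod 4 = 3"
      by linarith
    then show "(\<Sum>j=1..4. c j * w j l) = ucoef c (n l mod 4) m"
      using good_seq_mod_4[OF n, of l] unfolding four u ix
      by cases (auto simp: w_def, simp_all add: numeral_2_eq_2)
  qed
  finally show ?thesis using assms by (simp add: bsum_def A_def)
qed

lemma norm_bsum_le:
  fixes c :: "nat \<Rightarrow> complex"
  assumes "\<And>j. j \<in> {1..4} \<Longrightarrow> norm (c j) \<le> C"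
  shows "norm (bsum n c F m) \<le> C * divcount n F m"
proof (cases "m = 0")
  case False
  have "norm (\<Sum>l | l \<in> F \<and> n l dvd m. ucoef c (n l mod 4) m) \<le> (\<Sum>l | l \<in> F \<and> n l dvd m. C)"
    unfolding ucoef_def by (intro sum_norm_le assms idx_in)
  then show ?thesis using False by (simp add: bsum_def divcount_def mult.commute)
qed (simp add: bsum_def divcount_def)

text \<open>The part below \<open>L\<close> is periodic in positive \<open>m\<close>, the part from
  \<open>L\<close> on is rare near a well chosen centre; they are estimated separately.\<close>

lemma bsum_split:
  assumes "good_seq n"
  shows "bsum n c UNIV m = bsum n c {..<L} m + bsum n c {L..} m"
proof (cases "m = 0")
  case False
  have fin: "finite {l. n l dvd m}" using finite_dvd_good_seq[OF assms] False by simp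
  have "(\<Sum>l | n l dvd m. ucoef c (n l mod 4) m)
     = (\<Sum>l\<in>{l. l < L \<and> n l dvd m} \<union> {l. l \<ge> L \<and> n l dvd m}. ucoef c (n l mod 4) m)"
    by (rule sum.cong) auto
  also have "\<dots> = (\<Sum>l | l < L \<and> n l dvd m. ucoef c (n l mod 4) m) + (\<Sum>l | l \<ge> L \<and> n l dvd m. ucoef c (n l mod 4) m)"
    by (rule sum.union_disjoint) (auto intro: finite_subset[OF _ fin])
  finally have "(\<Sum>l | n l dvd m. ucoef c (n l mod 4) m)
     = (\<Sum>l | l < L \<and> n l dvd m. ucoef c (n l mod 4) m) + (\<Sum>l | l \<ge> L \<and> n l dvd m. ucoef c (n l mod 4) m)" .
  with False show ?thesis by (simp add: bsum_def)
qed (simp add: bsum_def)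

lemma divcount_eq_0D:
  assumes "good_seq n" "divcount n F m = 0" "m > 0"
  shows "{l. l \<in> F \<and> n l dvd m} = {}"
proof -
  have "finite {l \<in> F. n l dvd m}"
    by (rule finite_subset[OF _ finite_dvd_good_seq[OF assms(1,3)]]) auto
  with assms show ?thesis by (simp add: divcount_def)
qed

lemma bsum_eq_0:
  assumes "good_seq n" "divcount n F m = 0"
  shows "bsum n c F m = 0"
proof (cases "m = 0")
  case False
  then have "m > 0" by simp
  show ?thesis unfolding bsum_def divcount_eq_0D[OF assms \<open>m > 0\<close>] by simp
qed (simp add: bsum_def)

text \<open>The modulus is divisible by 4 and by each \<open>n l\<close> with \<open>l < L\<close>.
  Positivity sets aside the exceptional value at 0.\<close>

lemma bsum_periodic:
  assumes "[m = m'] (mod 4 * (\<Prod>l<L. n l))" "m > 0" "m' > 0"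
  shows "bsum n c {..<L} m = bsum n c {..<L} m'"
proof -
  have "m mod 4 = m' mod 4"
    using assms(1) cong_dvd_modulus_nat[of m m' _ 4] by (auto simp: cong_def[symmetric])
  moreover have "n l dvd m \<longleftrightarrow> n l dvd m'" if "l < L" for l
  proof (rule cong_dvd_iff)
    have "n l dvd (\<Prod>l<L. n l)" using that by (intro dvd_prodI) auto
    then show "[m = m'] (mod n l)" using assms(1) by (intro cong_dvd_modulus_nat[OF assms(1)]) simp
  qed
  ultimately show ?thesis
    using assms(2,3) unfolding bsum_def by (auto intro!: sum.cong ucoef_cong)
qed

text \<open>A Horner step: multiplication by \<open>x\<close> moves on by one index and the new
  coefficient is split off. It later carries zeros from one index to the next.\<close>

lemma tailpoly_Suc:
  "ev (tailpoly n g (Suc M)) x = x * ev (tailpoly n g M) x - ev (bsum n g UNIV (Suc M)) x"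
proof -
  have "(\<Sum>i<Suc M. ev (bsum n g UNIV (Suc M - i)) x * x ^ i)
      = ev (bsum n g UNIV (Suc M)) x + x * (\<Sum>i<M. ev (bsum n g UNIV (M - i)) x * x ^ i)"
    by (subst sum.lessThan_Suc_shift) (simp add: sum_distrib_left mult_ac)
  then show ?thesis unfolding tailpoly_def ev_minus ev_add ev_mult ev_sum ev_monom
    by (simp only: power_Suc) (simp add: algebra_simps)
qed

text \<open>Inside the disk the polynomial itself looks back from \<open>M\<close> with weights at
  most \<open>\<theta> ^ i\<close>. The constant 2 bounds the two terms with \<open>g 0\<close>, the
  summand with \<open>L\<close> the periodic part beyond the common stretch, and \<open>wsum\<close>
  the rest.\<close>

lemma norm_tailpoly_diff_inside:
  assumes n: "good_seq n" and \<theta>: "0 < \<theta>" "\<theta> < 1" and \<beta>: "norm \<beta> \<le> \<theta>"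
    and C: "\<And>j. j \<in> {0..4} \<Longrightarrow> norm (ev (g j) \<beta>) \<le> C"
    and M: "M \<le> M'" "[M = M'] (mod 4 * (\<Prod>l<L. n l))"
  shows "norm (ev (tailpoly n g M' - tailpoly n g M) \<beta>) \<le>
    C * (wsum \<theta> (divcount n {L..}) M' + wsum \<theta> (divcount n {L..}) M + (2 + real L / (1 - \<theta>)) * \<theta> ^ M)"
proof -
  define c where "c j = ev (g j) \<beta>" for j
  define S where "S F M = (\<Sum>i<M. bsum n c F (M - i) * \<beta> ^ i)" for F M
  have C0: "C \<ge> 0" using C[of 0] norm_ge_zero by (metis atLeastAtMost_iff order.trans zero_le)
  have G: "ev (tailpoly n g M) \<beta> = - (c 0 * \<beta> ^ M + S {..<L} M + S {L..} M)" for M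
    by (simp add: tailpoly_def ev_sum ev_bsum c_def[symmetric] S_def bsum_split[OF n, of _ _ L]
        distrib_right sum.distrib)
  have d: "0 \<le> divcount n F m" "divcount n F m \<le> real m + 1" for m F
    by (rule divcount_nonneg divcount_le[OF n])+
  have pw: "norm (\<beta> ^ i) \<le> \<theta> ^ i" for i using \<beta> by (simp add: norm_power power_mono)
  have big: "norm (S {L..} M) \<le> C * wsum \<theta> (divcount n {L..}) M" for M
  proof -
    have "norm (S {L..} M) \<le> (\<Sum>i<M. C * divcount n {L..} (M - i) * \<theta> ^ i)"
      unfolding S_def
    proof (rule sum_norm_le)
      fix i
      show "norm (bsum n c {L..} (M - i) * \<beta> ^ i) \<le> C * divcount n {L..} (M - i) * \<theta> ^ i"
        unfolding norm_mult using C C0 pw d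
        by (intro mult_mono norm_bsum_le mult_nonneg_nonneg) (auto simp: c_def)
    qed
    also have "\<dots> = (\<Sum>m\<in>{1..M}. C * (divcount n {L..} m * \<theta> ^ gap m M))"
      by (rule sum.reindex_bij_witness[of _ "\<lambda>m. M - m" "\<lambda>m. M - m"]) (auto simp: gap_def)
    also have "\<dots> = C * (\<Sum>m\<in>{1..M}. divcount n {L..} m * \<theta> ^ gap m M)"
      by (simp add: sum_distrib_left)
    also have "\<dots> \<le> C * wsum \<theta> (divcount n {L..}) M"
      unfolding wsum_def using C0 d \<theta>
      by (intro mult_left_mono sum_le_suminf summable_gap) auto
    finally show ?thesis .
  qed
  have low: "norm (S {..<L} M' - S {..<L} M) \<le> C * (real L / (1 - \<theta>) * \<theta> ^ M)"
  proof -
    \<comment> \<open>Periodicity matches the last \<open>M\<close> coefficients up to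
      \<open>M'\<close> with those up to \<open>M\<close>; the earlier ones have weight at most
      \<open>\<theta> ^ M\<close> and involve at most \<open>L\<close> divisors each.\<close>
    have "S {..<L} M' = (\<Sum>i<M. bsum n c {..<L} (M' - i) * \<beta> ^ i) + (\<Sum>i\<in>{M..<M'}. bsum n c {..<L} (M' - i) * \<beta> ^ i)"
      unfolding S_def using M(1) by (subst sum.atLeastLessThan_concat[of 0 M M', symmetric, unfolded atLeast0LessThan]) auto
    also have "(\<Sum>i<M. bsum n c {..<L} (M' - i) * \<beta> ^ i) = S {..<L} M"
      unfolding S_def
    proof (rule sum.cong[OF refl])
      fix i assume "i \<in> {..<M}"
      then have i: "i < M" by simp
      have "[(M' - i) + i = (M - i) + i] (mod 4 * (\<Prod>l<L. n l))"
        using M i by (simp add: cong_sym)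
      then have "[M' - i = M - i] (mod 4 * (\<Prod>l<L. n l))"
        by (simp only: cong_add_rcancel_nat)
      then show "bsum n c {..<L} (M' - i) * \<beta> ^ i = bsum n c {..<L} (M - i) * \<beta> ^ i"
        using i M by (subst bsum_periodic[of "M' - i" "M - i" n L]) auto
    qed
    finally have "norm (S {..<L} M' - S {..<L} M) = norm (\<Sum>i\<in>{M..<M'}. bsum n c {..<L} (M' - i) * \<beta> ^ i)"
      by simp
    also have "\<dots> \<le> (\<Sum>i\<in>{M..<M'}. C * real L * \<theta> ^ i)"
    proof (rule sum_norm_le)
      fix i
      have "divcount n {..<L} m \<le> real L" for m
      proof -
        have "card {l \<in> {..<L}. n l dvd m} \<le> card {..<L}" by (intro card_mono) auto
        then show ?thesis by (simp add: divcount_def)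
      qed
      moreover have "norm (bsum n c {..<L} (M' - i)) \<le> C * divcount n {..<L} (M' - i)"
        using C by (intro norm_bsum_le) (auto simp: c_def)
      ultimately have "norm (bsum n c {..<L} (M' - i)) \<le> C * real L"
        using C0 by (meson mult_left_mono order_trans)
      then show "norm (bsum n c {..<L} (M' - i) * \<beta> ^ i) \<le> C * real L * \<theta> ^ i"
        unfolding norm_mult using pw C0 by (intro mult_mono) auto
    qed
    also have "\<dots> = (\<Sum>j<M'-M. C * real L * \<theta> ^ (j + M))"
      by (rule sum.reindex_bij_witness[of _ "\<lambda>j. j + M" "\<lambda>i. i - M"]) auto
    also have "\<dots> = C * real L * \<theta> ^ M * (\<Sum>j<M'-M. \<theta> ^ j)"
      by (simp add: sum_distrib_left power_add algebra_simps)
    also have "\<dots> \<le> C * real L * \<theta> ^ M * (\<Sum>j. \<theta> ^ j)"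
      using C0 \<theta> by (intro mult_left_mono sum_le_suminf summable_geometric) auto
    also have "(\<Sum>j. \<theta> ^ j) = 1 / (1 - \<theta>)" using \<theta> by (intro suminf_geometric) simp
    finally show ?thesis by (simp add: mult_ac)
  qed
  have c0: "norm (c 0 * \<beta> ^ K) \<le> C * \<theta> ^ M" if "K \<ge> M" for K
  proof -
    have "norm (c 0 * \<beta> ^ K) \<le> C * \<theta> ^ K"
      unfolding norm_mult using C[of 0] pw C0 by (intro mult_mono) (auto simp: c_def)
    also have "\<dots> \<le> C * \<theta> ^ M" using that \<theta> C0 by (intro mult_left_mono power_decreasing) auto
    finally show ?thesis .
  qed
  have "ev (tailpoly n g M' - tailpoly n g M) \<beta>
     = (c 0 * \<beta> ^ M - c 0 * \<beta> ^ M') - (S {..<L} M' - S {..<L} M) + (S {L..} M - S {L..} M')"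
    by (simp add: G)
  also have "norm \<dots> \<le> norm (c 0 * \<beta> ^ M - c 0 * \<beta> ^ M') + norm (S {..<L} M' - S {..<L} M) + norm (S {L..} M - S {L..} M')"
    by (meson norm_triangle_ineq norm_triangle_ineq4 add_right_mono order_trans)
  also have "norm (c 0 * \<beta> ^ M - c 0 * \<beta> ^ M') \<le> C * \<theta> ^ M + C * \<theta> ^ M"
    using c0[of M] c0[of M'] M(1) by (intro order_trans[OF norm_triangle_ineq4] add_mono) auto
  also have "norm (S {L..} M - S {L..} M') \<le> C * wsum \<theta> (divcount n {L..}) M + C * wsum \<theta> (divcount n {L..}) M'"
    by (intro order_trans[OF norm_triangle_ineq4] add_mono big)
  also note low
  finally show ?thesis by (simp add: algebra_simps)
qed

section \<open>The series at 1 / \<alpha> and their tails\<close>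

lemma summable_bsum:
  fixes c :: "nat \<Rightarrow> complex"
  assumes n: "good_seq n" and z: "norm z < 1"
  shows "summable (\<lambda>k. bsum n c F (Suc k) * z ^ Suc k)"
proof -
  define C where "C = (\<Sum>j\<in>{1..4}. norm (c j))"
  \<comment> \<open>Halfway between \<open>norm z\<close> and 1, hence positive even for
    \<open>z = 0\<close>, as the majorant demands.\<close>
  define \<theta> where "\<theta> = (norm z + 1) / 2"
  have \<theta>: "norm z \<le> \<theta>" "0 < \<theta>" "\<theta> < 1"
    using z by (simp_all add: \<theta>_def add_nonneg_pos)
  have c: "norm (c j) \<le> C" if "j \<in> {1..4}" for j
    unfolding C_def using that by (intro member_le_sum) auto
  have C0: "C \<ge> 0" unfolding C_def by (intro sum_nonneg) auto
  have "summable (\<lambda>k. C * ((real (Suc k) + 1) * \<theta> ^ Suc k))"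
    using summable_linear_power[OF \<theta>(2,3), of 1] by (intro summable_mult) (simp only: summable_Suc_iff[where f = "\<lambda>k. (real k + 1) * \<theta> ^ k"])
  then show ?thesis
  proof (rule summable_comparison_test')
    fix k
    have "norm (bsum n c F (Suc k)) \<le> C * divcount n F (Suc k)" using c by (rule norm_bsum_le)
    also have "\<dots> \<le> C * (real (Suc k) + 1)" using C0 by (intro mult_left_mono divcount_le n)
    finally have "norm (bsum n c F (Suc k)) * norm z ^ Suc k \<le> C * (real (Suc k) + 1) * \<theta> ^ Suc k"
      using \<theta> C0 by (intro mult_mono power_mono) auto
    then show "norm (bsum n c F (Suc k) * z ^ Suc k) \<le> C * ((real (Suc k) + 1) * \<theta> ^ Suc k)"
      by (simp only: norm_mult norm_power mult.assoc)
  qed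
qed

lemma fser_combination:
  assumes n: "good_seq n" and z: "norm z < 1"
  shows "(\<Sum>j=1..4. c j * fser n j z) = (\<Sum>k. bsum n c UNIV (Suc k) * z ^ Suc k)"
proof -
  have s: "summable (\<lambda>k. of_nat (bcoef n j (Suc k)) * z ^ Suc k)" if "j \<in> {1..4}" for j
  proof -
    \<comment> \<open>A single series is the combination with indicator coefficients.\<close>
    have "bsum n (\<lambda>i. if i = j then 1 else 0 :: complex) UNIV m = of_nat (bcoef n j m)" if "m > 0" for m
      using sum_bcoef_eq_bsum[OF n that, of "\<lambda>i. if i = j then 1 else 0", symmetric] \<open>j \<in> {1..4}\<close>
      by (simp add: if_distrib[of "\<lambda>x. x * _"] cong: if_cong)
    then show ?thesis
      using summable_bsum[OF n z, of "\<lambda>i. if i = j then 1 else 0" UNIV] by simp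
  qed
  have "(\<Sum>j=1..4. c j * fser n j z) = (\<Sum>j=1..4. \<Sum>k. c j * (of_nat (bcoef n j (Suc k)) * z ^ Suc k))"
    unfolding fser_def by (intro sum.cong refl suminf_mult[symmetric] s)
  also have "\<dots> = (\<Sum>k. \<Sum>j=1..4. c j * (of_nat (bcoef n j (Suc k)) * z ^ Suc k))"
    by (intro suminf_sum[symmetric] summable_mult s)
  also have "\<dots> = (\<Sum>k. bsum n c UNIV (Suc k) * z ^ Suc k)"
    by (simp add: sum_bcoef_eq_bsum[OF n, symmetric] sum_distrib_right mult.assoc)
  finally show ?thesis .
qed

text \<open>The relation makes the negated initial segment equal to the remainder of the series;
  scaling by \<open>\<alpha> ^ M\<close> turns the former into \<open>tailpoly\<close>.\<close>

lemma ev_tailpoly_eq_tail: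
  assumes n: "good_seq n" and \<alpha>: "norm \<alpha> > 1"
    and rel: "ev (g 0) \<alpha> + (\<Sum>j=1..4. ev (g j) \<alpha> * fser n j (1 / \<alpha>)) = 0"
  shows "ev (tailpoly n g M) \<alpha> = (\<Sum>i. bsum n (\<lambda>j. ev (g j) \<alpha>) UNIV (M + Suc i) * (1 / \<alpha>) ^ Suc i)"
proof -
  define c where "c j = ev (g j) \<alpha>" for j
  define z where "z = 1 / \<alpha>"
  have z: "norm z < 1" using \<alpha> by (auto simp: z_def norm_divide divide_less_eq)
  have z0: "\<alpha> \<noteq> 0" using \<alpha> by auto
  define t where "t k = bsum n c UNIV (Suc k) * z ^ Suc k" for k
  have s: "summable t" unfolding t_def by (rule summable_bsum[OF n z])
  have "c 0 + (\<Sum>k. t k) = 0"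
    using rel unfolding c_def[symmetric] z_def[symmetric] fser_combination[OF n z] t_def .
  then have "- c 0 = (\<Sum>k. t k)" by (metis add_eq_0_iff)
  also have "\<dots> = (\<Sum>k. t (k + M)) + (\<Sum>k<M. t k)" by (rule suminf_split_initial_segment[OF s])
  finally have "- c 0 * \<alpha> ^ M = \<alpha> ^ M * (\<Sum>k. t (k + M)) + (\<Sum>k<M. \<alpha> ^ M * t k)"
    by (simp add: algebra_simps sum_distrib_left)
  also have "(\<Sum>k<M. \<alpha> ^ M * t k) = (\<Sum>i<M. bsum n c UNIV (M - i) * \<alpha> ^ i)"
  proof (rule sum.reindex_bij_witness[of _ "\<lambda>i. M - Suc i" "\<lambda>i. M - Suc i"])
    fix k assume "k \<in> {..<M}"
    then have k: "Suc k \<le> M" by simp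
    have "\<alpha> ^ M = \<alpha> ^ (M - Suc k) * \<alpha> ^ Suc k" using k by (simp only: power_add[symmetric]) simp
    then show "bsum n c UNIV (M - (M - Suc k)) * \<alpha> ^ (M - Suc k) = \<alpha> ^ M * t k"
      using k z0 by (simp add: t_def z_def power_one_over)
  qed auto
  also have "\<alpha> ^ M * (\<Sum>k. t (k + M)) = (\<Sum>k. \<alpha> ^ M * t (k + M))"
    by (intro suminf_mult[symmetric] summable_ignore_initial_segment s)
  also have "\<dots> = (\<Sum>k. bsum n c UNIV (M + Suc k) * z ^ Suc k)"
    using z0 by (simp add: t_def z_def power_add power_one_over add.commute)
  finally show ?thesis
    unfolding c_def[symmetric] z_def[symmetric]
    by (simp add: tailpoly_def ev_sum ev_bsum c_def[symmetric] algebra_simps)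
qed

text \<open>At \<alpha> the tail looks forward from \<open>M\<close>, and the periodic parts cancel
  term by term at all positive offsets. Unlike inside the disk no boundary term remains.\<close>

lemma norm_tailpoly_diff_outside:
  assumes n: "good_seq n" and \<alpha>: "norm \<alpha> > 1" and \<theta>: "1 / norm \<alpha> \<le> \<theta>" "\<theta> < 1"
    and rel: "ev (g 0) \<alpha> + (\<Sum>j=1..4. ev (g j) \<alpha> * fser n j (1 / \<alpha>)) = 0"
    and C: "\<And>j. j \<in> {0..4} \<Longrightarrow> norm (ev (g j) \<alpha>) \<le> C"
    and M: "[M = M'] (mod 4 * (\<Prod>l<L. n l))"
  shows "norm (ev (tailpoly n g M' - tailpoly n g M) \<alpha>) \<le>
    C * (wsum \<theta> (divcount n {L..}) M' + wsum \<theta> (divcount n {L..}) M)"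
proof -
  define c where "c j = ev (g j) \<alpha>" for j
  define z where "z = 1 / \<alpha>"
  have z: "norm z < 1" "norm z \<le> \<theta>" using \<alpha> \<theta> by (auto simp: z_def norm_divide divide_less_eq)
  have \<theta>0: "0 < \<theta>" using \<alpha> \<theta>(1) by (smt (verit) divide_pos_pos)
  have C0: "C \<ge> 0" using C[of 0] norm_ge_zero by (metis atLeastAtMost_iff order.trans zero_le)
  define d where "d = divcount n {L..}"
  have d: "0 \<le> d m" "d m \<le> real m + 1" for m
    unfolding d_def by (rule divcount_nonneg divcount_le[OF n])+
  have sd: "summable (\<lambda>i. d (M + Suc i) * \<theta> ^ Suc i)" 
    and led: "(\<Sum>i. d (M + Suc i) * \<theta> ^ Suc i) \<le> wsum \<theta> d M" for M
  proof -
    have s: "summable (\<lambda>m. d m * \<theta> ^ gap m M)" by (intro summable_gap \<theta>0 \<theta> d)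
    have eq: "(\<lambda>i. d (i + Suc M) * \<theta> ^ gap (i + Suc M) M) = (\<lambda>i. d (M + Suc i) * \<theta> ^ Suc i)"
      by (intro ext) (simp add: gap_def add.commute)
    show "summable (\<lambda>i. d (M + Suc i) * \<theta> ^ Suc i)"
      using summable_ignore_initial_segment[OF s, of "Suc M"] by (simp only: eq)
    have "wsum \<theta> d M = (\<Sum>i. d (M + Suc i) * \<theta> ^ Suc i) + (\<Sum>m<Suc M. d m * \<theta> ^ gap m M)"
      unfolding wsum_def by (subst suminf_split_initial_segment[OF s, where k = "Suc M"]) (simp only: eq)
    moreover have "0 \<le> (\<Sum>m<Suc M. d m * \<theta> ^ gap m M)"
      using d \<theta>0 by (intro sum_nonneg) auto
    ultimately show "(\<Sum>i. d (M + Suc i) * \<theta> ^ Suc i) \<le> wsum \<theta> d M" by linarith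
  qed
  have sb: "summable (\<lambda>i. bsum n c UNIV (M + Suc i) * z ^ Suc i)" for M
  proof -
    have "summable (\<lambda>i. \<alpha> ^ M * (bsum n c UNIV (Suc (i + M)) * z ^ Suc (i + M)))"
      using summable_ignore_initial_segment[OF summable_bsum[OF n z(1), of c UNIV], of M]
      by (intro summable_mult) simp
    moreover have "\<alpha> ^ M * (bsum n c UNIV (Suc (i + M)) * z ^ Suc (i + M)) = bsum n c UNIV (M + Suc i) * z ^ Suc i" for i
      using \<alpha> by (auto simp: z_def power_add power_one_over add.commute)
    ultimately show ?thesis by (simp only:)
  qed
  have "ev (tailpoly n g M' - tailpoly n g M) \<alpha>
      = (\<Sum>i. bsum n c UNIV (M' + Suc i) * z ^ Suc i) - (\<Sum>i. bsum n c UNIV (M + Suc i) * z ^ Suc i)"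
    using ev_tailpoly_eq_tail[OF n \<alpha> rel] unfolding c_def[symmetric] z_def[symmetric]
    by (simp only: ev_diff)
  also have "\<dots> = (\<Sum>i. bsum n c UNIV (M' + Suc i) * z ^ Suc i - bsum n c UNIV (M + Suc i) * z ^ Suc i)"
    by (intro suminf_diff sb)
  finally have eq: "ev (tailpoly n g M' - tailpoly n g M) \<alpha>
      = (\<Sum>i. bsum n c UNIV (M' + Suc i) * z ^ Suc i - bsum n c UNIV (M + Suc i) * z ^ Suc i)" .
  have "norm (ev (tailpoly n g M' - tailpoly n g M) \<alpha>) \<le> (\<Sum>i. C * (d (M' + Suc i) * \<theta> ^ Suc i + d (M + Suc i) * \<theta> ^ Suc i))"
    unfolding eq
  proof (rule norm_suminf_le)
    fix i
    have "[M' + Suc i = M + Suc i] (mod 4 * (\<Prod>l<L. n l))"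
      using M by (simp only: cong_add_rcancel_nat) (rule cong_sym)
    then have "bsum n c {..<L} (M' + Suc i) = bsum n c {..<L} (M + Suc i)"
      by (rule bsum_periodic) auto
    then have "bsum n c UNIV (M' + Suc i) * z ^ Suc i - bsum n c UNIV (M + Suc i) * z ^ Suc i
       = (bsum n c {L..} (M' + Suc i) - bsum n c {L..} (M + Suc i)) * z ^ Suc i"
      unfolding bsum_split[OF n, of _ _ L] by (simp only: algebra_simps)
    also have "norm \<dots> \<le> (C * d (M' + Suc i) + C * d (M + Suc i)) * \<theta> ^ Suc i"
      unfolding norm_mult norm_power d_def using z C C0 divcount_nonneg
      by (intro mult_mono power_mono order_trans[OF norm_triangle_ineq4] add_mono norm_bsum_le)
        (auto simp: c_def)
    finally show "norm (bsum n c UNIV (M' + Suc i) * z ^ Suc i - bsum n c UNIV (M + Suc i) * z ^ Suc i)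
        \<le> C * (d (M' + Suc i) * \<theta> ^ Suc i + d (M + Suc i) * \<theta> ^ Suc i)"
      by (simp only: algebra_simps)
  next
    show "summable (\<lambda>i. C * (d (M' + Suc i) * \<theta> ^ Suc i + d (M + Suc i) * \<theta> ^ Suc i))"
      by (intro summable_mult summable_add sd)
  qed
  also have "\<dots> = C * ((\<Sum>i. d (M' + Suc i) * \<theta> ^ Suc i) + (\<Sum>i. d (M + Suc i) * \<theta> ^ Suc i))"
    by (subst suminf_add[OF sd[of M'] sd[of M]])
       (rule suminf_mult[OF summable_add[OF sd[of M'] sd[of M]]])
  also have "\<dots> \<le> C * (wsum \<theta> d M' + wsum \<theta> d M)"
    using C0 by (intro mult_left_mono add_mono led)
  finally show ?thesis unfolding d_def .
qed

section \<open>Linear independence\<close>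

lemma good_seq_tail_sum:
  assumes "good_seq n" "\<epsilon> > 0"
  obtains L0 where "\<And>L F. L \<ge> L0 \<Longrightarrow> F \<subseteq> {L..} \<Longrightarrow> (\<Sum>l. if l \<in> F then 1 / real (n l) else 0) < \<epsilon>"
proof -
  have s: "summable (\<lambda>l. 1 / real (n l))" using assms by (simp add: good_seq_def)
  obtain L0 where L0: "\<And>m. m \<ge> L0 \<Longrightarrow> norm (\<Sum>i. 1 / real (n (i + m))) < \<epsilon>"
    using suminf_exist_split[OF assms(2) s] by blast
  have "(\<Sum>l. if l \<in> F then 1 / real (n l) else 0) < \<epsilon>" if L: "L \<ge> L0" "F \<subseteq> {L..}" for L F
  proof -
    have s': "summable (\<lambda>l. if l \<in> F then 1 / real (n l) else 0)"
      by (rule summable_comparison_test'[OF s]) simp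
    have "(\<Sum>l<L. if l \<in> F then 1 / real (n l) else 0) = 0"
      using L(2) by (intro sum.neutral) auto
    then have "(\<Sum>l. if l \<in> F then 1 / real (n l) else 0) = (\<Sum>i. if i + L \<in> F then 1 / real (n (i + L)) else 0)"
      using suminf_split_initial_segment[OF s', of L] by simp
    also have "\<dots> \<le> (\<Sum>i. 1 / real (n (i + L)))"
      using s s' by (intro suminf_le summable_ignore_initial_segment) (auto simp: summable_iff_shift[of "\<lambda>l. if l \<in> F then 1 / real (n l) else 0"])
    also have "\<dots> < \<epsilon>" using L0[OF L(1)] by simp
    finally show ?thesis .
  qed
  then show ?thesis by (rule that)
qed

lemma wsum_add:
  assumes "0 < \<theta>" "\<theta> < 1" "\<And>m. 0 \<le> a m" "\<And>m. a m \<le> real m + 1" "\<And>m. 0 \<le> b m" "\<And>m. b m \<le> real m + 1"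
  shows "wsum \<theta> (\<lambda>m. a m + b m) M = wsum \<theta> a M + wsum \<theta> b M"
  unfolding wsum_def using suminf_add[OF summable_gap[of \<theta> a M] summable_gap[of \<theta> b M]] assms
  by (simp add: distrib_right)

lemma wsum_single: "wsum \<theta> (\<lambda>m. if m = N then 1 else 0) M = \<theta> ^ gap N M"
proof -
  have "wsum \<theta> (\<lambda>m. if m = N then 1 else 0) M = (\<Sum>m. if m = N then \<theta> ^ gap N M else 0)"
    unfolding wsum_def by (intro suminf_cong) auto
  also have "\<dots> = \<theta> ^ gap N M"
    using suminf_finite[of "{N}" "\<lambda>m. if m = N then \<theta> ^ gap N M else 0"] by simp
  finally show ?thesis .
qed

text \<open>Other multiples of \<open>q\<close> lie at distance at least \<open>q\<close> from
  \<open>N\<close>; the factor 2 accounts for the two sides.\<close>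

lemma wsum_multiples_le:
  assumes "0 < \<theta>" "\<theta> < 1" "q dvd N"
  shows "wsum \<theta> (\<lambda>m. if 0 < m \<and> q dvd m \<and> m \<noteq> N then 1 else 0) N \<le> 2 * \<theta> ^ q / (1 - \<theta>)"
proof -
  define e where "e m = (if 0 < m \<and> q dvd m \<and> m \<noteq> N then 1 else 0 :: real)" for m
  have e: "0 \<le> e m" "e m \<le> real m + 1" for m by (simp_all add: e_def)
  have far: "e (N + i) = 0" "e (N - i) = 0" if "i < q" for i
  proof -
    have "e m = 0" if "m = N + i \<or> m = N - i" for m
    proof (rule ccontr)
      assume "e m \<noteq> 0"
      then have m: "0 < m" "q dvd m" "m \<noteq> N" by (auto simp: e_def split: if_splits)
      then have "q dvd N - m" "q dvd m - N" using assms(3) by (auto intro: dvd_diff_nat)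
      moreover have "(m - N = i \<and> i > 0) \<or> (N - m = i \<and> i > 0)" using that m by auto
      ultimately have "q dvd i" "i > 0" by auto
      then show False using \<open>i < q\<close> by (auto dest: dvd_imp_le)
    qed
    then show "e (N + i) = 0" "e (N - i) = 0" by auto
  qed
  note two = wsum_le_two_sided[OF assms(1,2), of e N, OF e]
  have "wsum \<theta> e N \<le> (\<Sum>i. (e (N + i) + e (N - i)) * \<theta> ^ i)" by (rule two)
  also have "\<dots> = (\<Sum>i. (e (N + (i + q)) + e (N - (i + q))) * \<theta> ^ (i + q))"
    using suminf_split_initial_segment[OF two(1), of q] far by simp
  also have "\<dots> \<le> (\<Sum>i. 2 * \<theta> ^ q * \<theta> ^ i)"
  proof (rule suminf_le)
    fix i
    have "(e (N + (i + q)) + e (N - (i + q))) * \<theta> ^ (i + q) \<le> 2 * \<theta> ^ (i + q)"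
      using assms by (intro mult_right_mono) (auto simp: e_def)
    then show "(e (N + (i + q)) + e (N - (i + q))) * \<theta> ^ (i + q) \<le> 2 * \<theta> ^ q * \<theta> ^ i"
      by (simp add: power_add mult_ac)
  next
    show "summable (\<lambda>i. (e (N + (i + q)) + e (N - (i + q))) * \<theta> ^ (i + q))"
      by (rule summable_ignore_initial_segment[OF two(1)])
    show "summable (\<lambda>i. 2 * \<theta> ^ q * \<theta> ^ i)"
      using assms by (intro summable_mult summable_geometric) simp
  qed
  also have "\<dots> = 2 * \<theta> ^ q * (\<Sum>i. \<theta> ^ i)"
    using assms by (intro suminf_mult summable_geometric) simp
  also have "\<dots> = 2 * \<theta> ^ q / (1 - \<theta>)" using assms by (simp add: suminf_geometric)
  finally show ?thesis unfolding e_def .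
qed

text \<open>\<open>N\<close> comes from averaging over all indices from \<open>L\<close> on. For
  \<open>N'\<close> the remainder theorem first prescribes the residue of \<open>N\<close> modulo
  \<open>4 * (\<Prod>l<L. n l)\<close> and 0 modulo \<open>n L\<close>, then averaging handles the
  indices above \<open>L\<close>; the other multiples of \<open>n L\<close> are harmless because
  \<open>n L\<close> is large. The correction at \<open>N'\<close> removes its divisor
  \<open>n L\<close> from the count.\<close>

lemma exists_twin_centres:
  assumes n: "good_seq n" and \<theta>: "0 < \<theta>" "\<theta> < 1" and \<epsilon>: "\<epsilon> > 0"
    and inf: "infinite {l. n l mod 4 = c}" and r: "r < 4"
  obtains L N N' where "n L mod 4 = c" "N mod 4 = r" "k < N" "N \<le> N'"
    "[N = N'] (mod 4 * (\<Prod>l<L. n l))" "n L dvd N'"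
    "(2 + real L / (1 - \<theta>)) * \<theta> ^ (N - k) < \<epsilon>"
    "wsum \<theta> (divcount n {L..}) N < \<epsilon>"
    "\<forall>m. 0 \<le> divcount n {L..} m - (if m = N' then 1 else 0)"
    "wsum \<theta> (\<lambda>m. divcount n {L..} m - (if m = N' then 1 else 0)) N' < \<epsilon>"
proof -
  have pos: "n l > 0" and odd: "odd (n l)" for l using n by (auto simp: good_seq_def)
  have cop: "coprime (n i) (n j)" if "i \<noteq> j" for i j using n that by (auto simp: good_seq_def)
  \<comment> \<open>With this size, tails of the reciprocal sum and \<open>\<theta> ^ n L\<close>
    alike cost less than \<open>\<epsilon> / 2\<close> after the factor
    \<open>2 / (1 - \<theta>)\<close>.\<close>
  define \<epsilon>1 where "\<epsilon>1 = \<epsilon> * (1 - \<theta>) / 4"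
  have \<epsilon>1: "\<epsilon>1 > 0" using \<epsilon> \<theta> by (simp add: \<epsilon>1_def)
  have eps: "2 * x / (1 - \<theta>) < \<epsilon> / 2" if "x < \<epsilon>1" for x
    using that \<theta> by (simp add: \<epsilon>1_def field_simps)
  obtain L0 where L0: "\<And>L F. L \<ge> L0 \<Longrightarrow> F \<subseteq> {L..} \<Longrightarrow> (\<Sum>l. if l \<in> F then 1 / real (n l) else 0) < \<epsilon>1"
    using good_seq_tail_sum[OF n \<epsilon>1] by blast
  have lim: "(\<lambda>i. \<theta> ^ i) \<longlonglongrightarrow> 0" using \<theta> by (intro LIMSEQ_realpow_zero) auto
  then have "\<forall>\<^sub>F i in sequentially. \<theta> ^ i < \<epsilon>1" using \<epsilon>1 by (rule order_tendstoD)
  then obtain L1 where L1: "\<And>i. i \<ge> L1 \<Longrightarrow> \<theta> ^ i < \<epsilon>1" by (auto simp: eventually_sequentially)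
  obtain L where L: "L \<ge> max L0 L1" "n L mod 4 = c"
    using inf unfolding infinite_nat_iff_unbounded_le by blast
  have nL: "\<theta> ^ n L < \<epsilon>1" using L good_seq_ge[OF n, of L] by (intro L1) auto
  define P where "P = 4 * (\<Prod>l<L. n l)"
  have P: "P > 0" using pos by (simp add: P_def prod_pos)
  have copP: "coprime P (n l)" if "l \<ge> L" for l
  proof -
    have "coprime 2 (n l)" using odd by simp
    then have "coprime (2 ^ 2) (n l)" by (rule coprime_power_left_iff[THEN iffD2, OF disjI1])
    then have "coprime 4 (n l)" by simp
    moreover have "coprime (\<Prod>l<L. n l) (n l)" using that by (intro prod_coprime_left cop) auto
    ultimately show ?thesis by (simp add: P_def coprime_mult_left_iff)
  qed
  have "(\<lambda>i. (2 + real L / (1 - \<theta>)) * \<theta> ^ i) \<longlonglongrightarrow> (2 + real L / (1 - \<theta>)) * 0"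
    by (intro tendsto_mult_left lim)
  then have "\<forall>\<^sub>F i in sequentially. (2 + real L / (1 - \<theta>)) * \<theta> ^ i < \<epsilon>"
    using \<epsilon> by (intro order_tendstoD) auto
  then obtain T where T: "\<And>i. i \<ge> T \<Longrightarrow> (2 + real L / (1 - \<theta>)) * \<theta> ^ i < \<epsilon>"
    by (auto simp: eventually_sequentially)
  \<comment> \<open>The starting value has residue \<open>r\<close> modulo 4, a divisor of
    \<open>P\<close>, and makes both \<open>N > k\<close> and \<open>N - k \<ge> T\<close>
    true.\<close>
  obtain N where N: "N \<ge> r + 4 * (T + k + 1)" "[N = r + 4 * (T + k + 1)] (mod P)"
      "wsum \<theta> (divcount n {L..}) N < \<epsilon>"
  proof (rule exists_small_wsum[OF n \<theta> P])
    show "coprime P (n l)" if "l \<in> {L..}" for l using that copP by simp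
    show "2 * (\<Sum>l. if l \<in> {L..} then 1 / real (n l) else 0) / (1 - \<theta>) < \<epsilon>"
      using eps[OF L0[of L "{L..}"]] L \<epsilon> by simp
  qed
  have "[N = r + 4 * (T + k + 1)] (mod 4)" using N(2) by (rule cong_dvd_modulus_nat) (simp add: P_def)
  then have "N mod 4 = r mod 4" by (simp only: cong_def mod_mult_self2)
  then have Nr: "N mod 4 = r" using r by simp
  obtain x where x: "[x = N] (mod P)" "[x = 0] (mod n L)"
    using binary_chinese_remainder_nat[OF copP[OF order_refl]] by blast
  \<comment> \<open>The added multiple of \<open>P * n L\<close> preserves both residues of
    \<open>x\<close> and forces \<open>N \<le> N'\<close>.\<close>
  obtain N' where N': "N' \<ge> x + P * n L * N" "[N' = x + P * n L * N] (mod P * n L)"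
      "wsum \<theta> (divcount n {L<..}) N' < \<epsilon> / 2"
  proof (rule exists_small_wsum[OF n \<theta>, of "P * n L" "{L<..}"])
    show "P * n L > 0" using P pos by simp
    show "coprime (P * n L) (n l)" if "l \<in> {L<..}" for l
      using that copP cop[of L l] by (simp add: coprime_mult_left_iff)
    show "2 * (\<Sum>l. if l \<in> {L<..} then 1 / real (n l) else 0) / (1 - \<theta>) < \<epsilon> / 2"
      using eps[OF L0[of L "{L<..}"]] L by (simp add: subset_iff)
  qed
  have "N \<le> P * n L * N" using P pos[of L] by (simp add: Suc_leI)
  then have le: "N \<le> N'" using N'(1) by linarith
  have "[N' = x] (mod P)"
    using cong_dvd_modulus_nat[OF N'(2), of P] by (simp add: cong_def mult.assoc)
  then have congP: "[N = N'] (mod P)" using x(1) by (meson cong_sym cong_trans)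
  have "[N' = x] (mod n L)"
    using cong_dvd_modulus_nat[OF N'(2), of "n L"] by (simp add: cong_def mult.assoc mult.left_commute[of P])
  then have dvd: "n L dvd N'" using x(2) by (meson cong_0_iff cong_trans)
  have N0: "N > k" using N(1) by simp
  \<comment> \<open>\<open>e\<close> marks the multiples of \<open>n L\<close> that remain after the
    correction at \<open>N'\<close>.\<close>
  define e where "e m = (if 0 < m \<and> n L dvd m \<and> m \<noteq> N' then 1 else 0 :: real)" for m
  have split: "divcount n {L..} m - (if m = N' then 1 else 0) = divcount n {L<..} m + e m" for m
  proof (cases "m = 0")
    case True
    then show ?thesis using N0 le by (simp add: divcount_def e_def)
  next
    case False
    have fin: "finite {l \<in> {L<..}. n l dvd m}"
      by (rule finite_subset[OF _ finite_dvd_good_seq[OF n]]) (use False in auto)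
    show ?thesis
    proof (cases "n L dvd m")
      case True
      have "{l \<in> {L..}. n l dvd m} = insert L {l \<in> {L<..}. n l dvd m}" using True by (auto simp: le_less)
      then have "card {l \<in> {L..}. n l dvd m} = Suc (card {l \<in> {L<..}. n l dvd m})"
        using fin by (simp only:) (subst card_insert_disjoint, auto)
      with True False show ?thesis by (simp add: divcount_def e_def)
    next
      case nd: False
      then have "{l \<in> {L..}. n l dvd m} = {l \<in> {L<..}. n l dvd m}" by (auto simp: le_less)
      moreover have "m \<noteq> N'" using nd dvd by auto
      ultimately show ?thesis using nd by (simp add: divcount_def e_def)
    qed
  qed
  have "wsum \<theta> (\<lambda>m. divcount n {L<..} m + e m) N' = wsum \<theta> (divcount n {L<..}) N' + wsum \<theta> e N'"
    by (intro wsum_add \<theta> divcount_nonneg divcount_le n) (auto simp: e_def)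
  also have "\<dots> < \<epsilon> / 2 + \<epsilon> / 2"
    using N'(3) wsum_multiples_le[OF \<theta> dvd] eps[OF nL] unfolding e_def by (intro add_strict_mono) auto
  finally have w: "wsum \<theta> (\<lambda>m. divcount n {L..} m - (if m = N' then 1 else 0)) N' < \<epsilon>"
    unfolding split by simp
  show ?thesis
  proof (rule that[of L N N'])
    show "(2 + real L / (1 - \<theta>)) * \<theta> ^ (N - k) < \<epsilon>" using N(1) by (intro T) simp
    show "\<forall>m. 0 \<le> divcount n {L..} m - (if m = N' then 1 else 0)"
      unfolding split by (simp add: divcount_nonneg e_def)
  qed (use L Nr N0 le congP dvd N w in \<open>auto simp: P_def\<close>)
qed

text \<open>The scaled tails around \<open>N\<close> and \<open>N'\<close> are compared at distance
  \<open>k\<close> on both sides. Their differences vanish there by discreteness, yet in between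
  only the divisor \<open>n L\<close> of \<open>N'\<close> can create a nonzero difference, so its
  coefficient is 0.\<close>

lemma ucoef_vanishes:
  assumes n: "good_seq n" and int: "algebraic_int \<alpha>" and \<alpha>: "norm \<alpha> > 1"
    and conj: "\<And>\<beta>. conjugate_over_Q \<alpha> \<beta> \<Longrightarrow> \<beta> \<noteq> \<alpha> \<Longrightarrow> \<beta> \<noteq> cnj \<alpha> \<Longrightarrow> norm \<beta> < 1"
    and rel: "ev (g 0) \<alpha> + (\<Sum>j=1..4. ev (g j) \<alpha> * fser n j (1 / \<alpha>)) = 0"
    and inf: "infinite {l. n l mod 4 = c}" and r: "r < 4"
  shows "ev (ucoef g c r) \<alpha> = 0"
proof -
  obtain R \<delta> where R: "finite R" "\<And>\<beta>. \<beta> \<in> R \<Longrightarrow> conjugate_over_Q \<alpha> \<beta>" "\<delta> > 0"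
    "\<And>g. (\<And>\<beta>. \<beta> \<in> R \<Longrightarrow> norm (ev g \<beta>) < \<delta>) \<Longrightarrow> ev g \<alpha> = 0"
    using algebraic_int_discrete[OF int] by metis
  \<comment> \<open>One damping rate for all conjugates: it dominates
    \<open>1 / norm \<alpha>\<close> for those outside the disk and the moduli of those inside; the
    first entry keeps \<open>\<theta>\<close> positive.\<close>
  define S where "S = insert (1 / norm \<alpha>) (norm ` {\<beta> \<in> R. norm \<beta> < 1})"
  define \<theta> where "\<theta> = Max S"
  have finS: "finite S" using R(1) by (simp add: S_def)
  have S1: "s < 1" if "s \<in> S" for s using that \<alpha> by (auto simp: S_def divide_less_eq)
  have "S \<noteq> {}" by (simp add: S_def)
  then have \<theta>1: "\<theta> < 1" unfolding \<theta>_def by (rule S1[OF Max_in[OF finS]])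
  have \<theta>\<alpha>: "1 / norm \<alpha> \<le> \<theta>" unfolding \<theta>_def using finS by (intro Max_ge) (auto simp: S_def)
  have \<theta>0: "0 < \<theta>" using \<theta>\<alpha> \<alpha> by (smt (verit) divide_pos_pos)
  have \<theta>R: "norm \<beta> \<le> \<theta>" if "\<beta> \<in> R" "norm \<beta> < 1" for \<beta>
    unfolding \<theta>_def using finS that by (intro Max_ge) (auto simp: S_def)
  define C where "C = 1 + (\<Sum>\<beta>\<in>insert \<alpha> R. \<Sum>j\<in>{0..4}. norm (ev (g j) \<beta>))"
  have C1: "C \<ge> 1" unfolding C_def by (simp add: sum_nonneg)
  have C: "norm (ev (g j) \<beta>) \<le> C" if "j \<in> {0..4}" "\<beta> \<in> insert \<alpha> R" for j \<beta>
  proof -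
    have "norm (ev (g j) \<beta>) \<le> (\<Sum>j\<in>{0..4}. norm (ev (g j) \<beta>))"
      using that by (intro member_le_sum) auto
    also have "\<dots> \<le> (\<Sum>\<beta>\<in>insert \<alpha> R. \<Sum>j\<in>{0..4}. norm (ev (g j) \<beta>))"
      using that R(1) by (intro member_le_sum[of \<beta> "insert \<alpha> R" "\<lambda>\<beta>. \<Sum>j\<in>{0..4}. norm (ev (g j) \<beta>)"]) (auto intro: sum_nonneg)
    finally show ?thesis by (simp add: C_def)
  qed
  have "(\<lambda>i. C * \<theta> ^ i) \<longlonglongrightarrow> C * 0"
    using \<theta>0 \<theta>1 by (intro tendsto_mult_left LIMSEQ_realpow_zero) auto
  then have "\<forall>\<^sub>F i in sequentially. C * \<theta> ^ i < \<delta> / 2"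
    using R(3) by (intro order_tendstoD) auto
  then obtain k0 where k0: "\<And>i. i \<ge> k0 \<Longrightarrow> C * \<theta> ^ i < \<delta> / 2" by (auto simp: eventually_sequentially)
  \<comment> \<open>At distance \<open>k\<close> the divisor \<open>n L\<close> of \<open>N'\<close>
    contributes less than \<open>\<delta> / 2\<close>. The successor provides an index
    \<open>k0\<close> just before the centre.\<close>
  define k where "k = Suc k0"
  have k: "C * \<theta> ^ k < \<delta> / 2" by (rule k0) (simp add: k_def)
  \<comment> \<open>The bound by \<open>\<theta> ^ k\<close> excludes unwanted divisors within
    distance \<open>k\<close>; the bound with \<open>\<delta>\<close> lets three error terms of size
    \<open>\<epsilon> / \<theta> ^ k\<close> fit into the other half of
    \<open>\<delta>\<close>.\<close>
  define \<epsilon> where "\<epsilon> = \<theta> ^ k * min 1 (\<delta> / (6 * C))"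
  have \<epsilon>0: "\<epsilon> > 0" using \<theta>0 R(3) C1 by (simp add: \<epsilon>_def)
  have \<epsilon>k: "\<epsilon> \<le> \<theta> ^ k" using \<theta>0 by (simp add: \<epsilon>_def mult_left_le)
  have "\<epsilon> \<le> \<theta> ^ k * (\<delta> / (6 * C))" unfolding \<epsilon>_def using \<theta>0 by (intro mult_left_mono) auto
  then have "6 * C * \<epsilon> \<le> \<delta> * \<theta> ^ k" using C1 by (simp add: field_simps)
  then have \<epsilon>C: "3 * C * (\<epsilon> / \<theta> ^ k) \<le> \<delta> / 2" using \<theta>0 by (simp add: field_simps)
  have \<epsilon>le: "\<epsilon> \<le> \<epsilon> / \<theta> ^ k" using \<epsilon>0 \<theta>0 \<theta>1 by (simp add: field_simps mult_left_le power_le_one)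
  obtain L N N' where L: "n L mod 4 = c" and N: "N mod 4 = r" "k < N" "N \<le> N'"
    and cong: "[N = N'] (mod 4 * (\<Prod>l<L. n l))" and dvd: "n L dvd N'"
    and init: "(2 + real L / (1 - \<theta>)) * \<theta> ^ (N - k) < \<epsilon>"
    and wN: "wsum \<theta> (divcount n {L..}) N < \<epsilon>"
    and d'0: "\<forall>m. 0 \<le> divcount n {L..} m - (if m = N' then 1 else 0)"
    and wN': "wsum \<theta> (\<lambda>m. divcount n {L..} m - (if m = N' then 1 else 0)) N' < \<epsilon>"
    by (rule exists_twin_centres[OF n \<theta>0 \<theta>1 \<epsilon>0 inf r, of k])
  define d where "d = divcount n {L..}"
  define d' where "d' m = d m - (if m = N' then 1 else 0)" for m
  have d: "0 \<le> d m" "d m \<le> real m + 1" for m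
    unfolding d_def by (rule divcount_nonneg divcount_le[OF n])+
  have d': "0 \<le> d' m" "d' m \<le> real m + 1" for m
    using d'0[rule_format, of m] d[of m] by (auto simp: d'_def d_def)
  have dN: "wsum \<theta> d N < \<epsilon>" and d'N': "wsum \<theta> d' N' < \<epsilon>" using wN wN' by (simp_all add: d_def d'_def[abs_def])
  have integral: "d m \<in> \<int>" "d' m \<in> \<int>" for m by (auto simp: d_def d'_def divcount_def)
  \<comment> \<open>A positive integral value within distance \<open>k\<close> would alone
    contribute at least \<open>\<theta> ^ k\<close>.\<close>
  have zero: "a m = 0" if "\<And>m. 0 \<le> a m" "\<And>m. a m \<le> real m + 1" "\<And>m. a m \<in> \<int>" "wsum \<theta> a M < \<epsilon>" "gap m M \<le> k"
    for a :: "nat \<Rightarrow> real" and m M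
  proof (rule ccontr)
    assume "a m \<noteq> 0"
    then have "1 \<le> a m" using that(1)[of m] that(3)[of m] by (auto elim!: Ints_cases)
    have "\<theta> ^ k \<le> 1 * \<theta> ^ gap m M" using that(5) \<theta>0 \<theta>1 by (simp add: power_decreasing)
    also have "\<dots> \<le> a m * \<theta> ^ gap m M" using \<open>1 \<le> a m\<close> \<theta>0 by (intro mult_right_mono) auto
    also have "\<dots> \<le> wsum \<theta> a M" by (rule term_le_wsum[OF \<theta>0 \<theta>1 that(1,2)])
    also have "\<dots> < \<epsilon>" by (rule that)
    finally show False using \<epsilon>k by simp
  qed
  have near: "d m = 0" if "gap m N \<le> k" for m by (rule zero[OF d integral(1) dN that])
  have near': "d' m = 0" if "gap m N' \<le> k" for m by (rule zero[OF d' integral(2) d'N' that])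
  \<comment> \<open>The errors from \<open>M\<close>, from \<open>M'\<close> and from the boundary
    are each at most \<open>\<epsilon> / \<theta> ^ k\<close>, and the divisor at \<open>N'\<close>
    adds \<open>\<theta> ^ k\<close>; with the factor \<open>C\<close> every conjugate stays below
    \<open>\<delta>\<close>.\<close>
  have small: "ev (tailpoly n g M' - tailpoly n g M) \<alpha> = 0"
    if M: "M \<le> M'" "[M = M'] (mod 4 * (\<Prod>l<L. n l))" "N - k \<le> M" "gap M N = k" "gap M' N' = k" "gap N' M' = k" for M M'
  proof (rule R(4))
    fix \<beta> assume \<beta>: "\<beta> \<in> R"
    have "wsum \<theta> d M \<le> wsum \<theta> d N / \<theta> ^ k"
      using wsum_shift_le[OF \<theta>0 \<theta>1 d, of M N] by (simp add: M)
    also have "\<dots> \<le> \<epsilon> / \<theta> ^ k" using dN \<theta>0 by (intro divide_right_mono) auto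
    finally have 1: "wsum \<theta> d M \<le> \<epsilon> / \<theta> ^ k" .
    have "wsum \<theta> d M' = wsum \<theta> (\<lambda>m. d' m + (if m = N' then 1 else 0)) M'" by (simp add: d'_def)
    also have "\<dots> = wsum \<theta> d' M' + \<theta> ^ k"
      using wsum_add[OF \<theta>0 \<theta>1 d', of "\<lambda>m. if m = N' then 1 else 0" M'] by (simp add: wsum_single M)
    also have "wsum \<theta> d' M' \<le> wsum \<theta> d' N' / \<theta> ^ k"
      using wsum_shift_le[OF \<theta>0 \<theta>1 d', of M' N'] by (simp add: M)
    also have "\<dots> \<le> \<epsilon> / \<theta> ^ k" using d'N' \<theta>0 by (intro divide_right_mono) auto
    finally have 2: "wsum \<theta> d M' \<le> \<epsilon> / \<theta> ^ k + \<theta> ^ k" by simp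
    have "(2 + real L / (1 - \<theta>)) * \<theta> ^ M \<le> (2 + real L / (1 - \<theta>)) * \<theta> ^ (N - k)"
      using \<theta>0 \<theta>1 M(3) by (intro mult_left_mono power_decreasing) auto
    then have 3: "(2 + real L / (1 - \<theta>)) * \<theta> ^ M \<le> \<epsilon> / \<theta> ^ k" using init \<epsilon>le by linarith
    have pos: "0 \<le> (2 + real L / (1 - \<theta>)) * \<theta> ^ M" using \<theta>0 \<theta>1 by (intro mult_nonneg_nonneg) auto
    define B where "B = C * (wsum \<theta> d M' + wsum \<theta> d M + (2 + real L / (1 - \<theta>)) * \<theta> ^ M)"
    have "norm (ev (tailpoly n g M' - tailpoly n g M) \<beta>) \<le> B"
    proof (cases "\<beta> = \<alpha> \<or> \<beta> = cnj \<alpha>")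
      case True
      then have "norm (ev (tailpoly n g M' - tailpoly n g M) \<beta>) = norm (ev (tailpoly n g M' - tailpoly n g M) \<alpha>)"
        by (metis ev_cnj complex_mod_cnj)
      also have "\<dots> \<le> C * (wsum \<theta> d M' + wsum \<theta> d M)"
        unfolding d_def by (rule norm_tailpoly_diff_outside[OF n \<alpha> \<theta>\<alpha> \<theta>1 rel _ M(2)]) (use C in auto)
      also have "\<dots> \<le> B" unfolding B_def using C1 pos by (intro mult_left_mono) auto
      finally show ?thesis .
    next
      case False
      then have "norm \<beta> \<le> \<theta>" using \<theta>R[OF \<beta>] conj[OF R(2)[OF \<beta>]] by blast
      then show ?thesis unfolding B_def d_def
        by (rule norm_tailpoly_diff_inside[OF n \<theta>0 \<theta>1 _ _ M(1,2)]) (use C \<beta> in auto)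
    qed
    also have "B \<le> C * (\<theta> ^ k + 3 * (\<epsilon> / \<theta> ^ k))"
      unfolding B_def using 1 2 3 C1 by (intro mult_left_mono) auto
    also have "\<dots> = C * \<theta> ^ k + 3 * C * (\<epsilon> / \<theta> ^ k)" by (simp add: distrib_left)
    also have "\<dots> < \<delta>" using k \<epsilon>C by linarith
    finally show "norm (ev (tailpoly n g M' - tailpoly n g M) \<beta>) < \<delta>" .
  qed
  \<comment> \<open>The offset \<open>j\<close> is used from \<open>0\<close> to
    \<open>k + k\<close>, with the centres at \<open>j = k\<close>.\<close>
  define x where "x j = ev (tailpoly n g (N' - k + j) - tailpoly n g (N - k + j)) \<alpha>" for j
  define u where "u m m' = ev (bsum n g UNIV m') \<alpha> - ev (bsum n g UNIV m) \<alpha>" for m m'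
  have congj: "[N - k + j = N' - k + j] (mod 4 * (\<Prod>l<L. n l))" for j
  proof -
    have "[(N - k) + k = (N' - k) + k] (mod 4 * (\<Prod>l<L. n l))" using cong N by simp
    then show ?thesis by (simp only: cong_add_rcancel_nat)
  qed
  have x0: "x 0 = 0" unfolding x_def
    by (rule small[OF _ congj]) (use N in \<open>auto simp: gap_def\<close>)
  have x2: "x (k + k) = 0" unfolding x_def
    by (rule small[OF _ congj]) (use N in \<open>auto simp: gap_def\<close>)
  have step: "x (Suc j) = \<alpha> * x j - u (N - k + Suc j) (N' - k + Suc j)" for j
    unfolding x_def u_def ev_diff add_Suc_right tailpoly_Suc by (simp add: algebra_simps)
  have bsum_diff: "u m m' = ev (bsum n g {L..} m') \<alpha> - ev (bsum n g {L..} m) \<alpha>"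
    if "[m = m'] (mod 4 * (\<Prod>l<L. n l))" "m > 0" "m' > 0" for m m'
    unfolding u_def bsum_split[OF n, of _ _ L] ev_add using bsum_periodic[OF that, of g] by simp
  \<comment> \<open>Off the centres no \<open>n l\<close> with \<open>l \<ge> L\<close> divides
    either position, and the periodic parts agree.\<close>
  have u0: "u (N - k + j) (N' - k + j) = 0" if "j \<le> k + k" "j \<noteq> k" for j
  proof -
    have "d (N - k + j) = 0" using that N by (intro near) (auto simp: gap_def)
    moreover have "d' (N' - k + j) = 0" using that N by (intro near') (auto simp: gap_def)
    then have "d (N' - k + j) = 0" using that N by (auto simp: d'_def split: if_splits)
    ultimately have "bsum n g {L..} (N - k + j) = 0" "bsum n g {L..} (N' - k + j) = 0"
      unfolding d_def by (blast intro: bsum_eq_0[OF n])+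
    then show ?thesis using bsum_diff[OF congj[of j]] N by simp
  qed
  have "x j = 0" if "j < k" for j
    using that
  proof (induction j)
    case (Suc j)
    then show ?case using step[of j] u0[of "Suc j"] by simp
  qed (simp add: x0)
  then have "x k0 = 0" by (simp add: k_def)
  then have xk: "x k = - u N N'" using step[of k0] N by (simp add: k_def)
  \<comment> \<open>Past the centre the difference is only multiplied by \<alpha>, so its vanishing
    at \<open>k + k\<close> leads back to \<open>u N N' = 0\<close>.\<close>
  have "x (k + j) = - (\<alpha> ^ j * u N N')" if "j \<le> k" for j
    using that
  proof (induction j)
    case (Suc j)
    then show ?case using step[of "k + j"] u0[of "k + Suc j"] by simp
  qed (simp add: xk)
  from this[of k] have "\<alpha> ^ k * u N N' = 0" using x2 by simp
  then have "u N N' = 0" using \<alpha> by auto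
  moreover have "u N N' = ev (ucoef g c r) \<alpha>"
  proof -
    \<comment> \<open>Among the indices from \<open>L\<close> on, none contributes at
      \<open>N\<close> and exactly \<open>L\<close> does at \<open>N'\<close>.\<close>
    have "d N = 0" by (rule near) (simp add: gap_def)
    then have z: "bsum n g {L..} N = 0" by (intro bsum_eq_0 n) (simp add: d_def)
    have "d' N' = 0" by (rule near') (simp add: gap_def)
    then have "card {l \<in> {L..}. n l dvd N'} = 1" using N by (simp add: d'_def d_def divcount_def)
    moreover have "L \<in> {l \<in> {L..}. n l dvd N'}" using dvd by simp
    ultimately have one: "{l. l \<in> {L..} \<and> n l dvd N'} = {L}" by (metis card_1_singletonE singletonD)
    have "bsum n g {L..} N' = ucoef g (n L mod 4) N'" unfolding bsum_def one using N by simp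
    also have "\<dots> = ucoef g c r" unfolding L
    proof (rule ucoef_cong)
      have "[N = N'] (mod 4)" using cong by (rule cong_dvd_modulus_nat) simp
      then show "N' mod 4 = r mod 4" using N r by (simp add: cong_def)
    qed
    finally show ?thesis using bsum_diff[OF cong] N z by simp
  qed
  ultimately show ?thesis by simp
qed

section \<open>Reduction to coefficients in Z[\<alpha>]\<close>

lemma rat_poly_clear_denominators:
  fixes p :: "rat poly"
  obtains D :: int and q where "D \<noteq> 0" "\<And>x. ev q x = of_int D * evq p x"
proof -
  have "\<exists>D q. D \<noteq> 0 \<and> (\<forall>x. ev q x = of_int D * evq p x)"
  proof (induction p)
    case 0
    show ?case by (intro exI[of _ 1] exI[of _ 0]) simp
  next
    case (pCons a p)
    then obtain D q where D: "D \<noteq> 0" "\<And>x. ev q x = of_int D * evq p x" by blast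
    obtain u v where uv: "a = of_int u / of_int v" "v \<noteq> 0"
      by (metis quotient_of_div quotient_of_denom_pos surj_pair less_irrefl)
    then have a: "(of_rat a :: complex) = of_int u / of_int v" by (simp add: of_rat_divide)
    have "ev (pCons (u * D) (smult v q)) x = of_int (v * D) * evq (pCons a p) x" for x
    proof -
      have "smult v q = [:v:] * q" by simp
      then have "ev (smult v q) x = of_int v * ev q x"
        using ev_mult[of "[:v:]" q x] by (simp add: map_poly_pCons del: ev_mult)
      then show ?thesis using D(2) uv(2) by (simp add: map_poly_pCons a field_simps)
    qed
    then show ?case using D uv by (intro exI[of _ "v * D"] exI) auto
  qed
  then show ?thesis using that by blast
qed

lemma Q_adjoin_int_fraction:
  assumes "x \<in> Q_adjoin \<alpha>"
  obtains p q where "ev q \<alpha> \<noteq> 0" "x * ev q \<alpha> = ev p \<alpha>"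
proof -
  obtain p q where pq: "x = evq p \<alpha> / evq q \<alpha>" "evq q \<alpha> \<noteq> 0"
    using assms by (auto simp: Q_adjoin_def)
  obtain D p' where p': "D \<noteq> 0" "\<And>x. ev p' x = of_int D * evq p x"
    using rat_poly_clear_denominators by blast
  obtain E q' where q': "E \<noteq> 0" "\<And>x. ev q' x = of_int E * evq q x"
    using rat_poly_clear_denominators by blast
  show ?thesis
  proof (rule that[of "[:D:] * q'" "[:E:] * p'"])
    show "ev ([:D:] * q') \<alpha> \<noteq> 0" using p' q' pq by (simp only: ev_mult) (simp add: map_poly_pCons)
    show "x * ev ([:D:] * q') \<alpha> = ev ([:E:] * p') \<alpha>"
      using p' q' pq by (simp only: ev_mult) (simp add: map_poly_pCons)
  qed
qed

lemma Q_adjoin_common_denominator: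
  assumes "finite I" "\<And>i. i \<in> I \<Longrightarrow> c i \<in> Q_adjoin \<alpha>"
  obtains q g where "ev q \<alpha> \<noteq> 0" "\<And>i. i \<in> I \<Longrightarrow> c i * ev q \<alpha> = ev (g i) \<alpha>"
proof -
  have "\<exists>p q. ev q \<alpha> \<noteq> 0 \<and> c i * ev q \<alpha> = ev p \<alpha>" if "i \<in> I" for i
    using Q_adjoin_int_fraction[OF assms(2)[OF that]] by metis
  then obtain p q where pq: "\<And>i. i \<in> I \<Longrightarrow> ev (q i) \<alpha> \<noteq> 0" "\<And>i. i \<in> I \<Longrightarrow> c i * ev (q i) \<alpha> = ev (p i) \<alpha>"
    by metis
  show ?thesis
  proof (rule that[of "\<Prod>i\<in>I. q i" "\<lambda>i. p i * (\<Prod>j\<in>I-{i}. q j)"])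
    show "ev (\<Prod>i\<in>I. q i) \<alpha> \<noteq> 0" using pq assms(1) by (simp add: ev_prod)
  next
    fix i assume i: "i \<in> I"
    have "c i * ev (\<Prod>i\<in>I. q i) \<alpha> = c i * ev (q i) \<alpha> * ev (\<Prod>j\<in>I-{i}. q j) \<alpha>"
      by (simp add: prod.remove[OF assms(1) i] mult.assoc)
    then show "c i * ev (\<Prod>i\<in>I. q i) \<alpha> = ev (p i * (\<Prod>j\<in>I-{i}. q j)) \<alpha>"
      using pq(2)[OF i] by simp
  qed
qed

theorem theorem1:
  fixes n :: "nat \<Rightarrow> nat" and \<alpha> :: complex
  assumes "good_seq n"
    and "algebraic_int \<alpha>"
    and "norm \<alpha> > 1"
    and "\<And>\<beta>. conjugate_over_Q \<alpha> \<beta> \<Longrightarrow> \<beta> \<noteq> \<alpha> \<Longrightarrow> \<beta> \<noteq> cnj \<alpha> \<Longrightarrow> norm \<beta> < 1"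
  shows "\<forall>c :: nat \<Rightarrow> complex. (\<forall>i\<in>{0..4}. c i \<in> Q_adjoin \<alpha>) \<longrightarrow>
           c 0 + (\<Sum>j=1..4. c j * fser n j (1 / \<alpha>)) = 0 \<longrightarrow> (\<forall>i\<in>{0..4}. c i = 0)"
proof (intro allI impI)
  fix c :: "nat \<Rightarrow> complex"
  assume c: "\<forall>i\<in>{0..4}. c i \<in> Q_adjoin \<alpha>" and rel: "c 0 + (\<Sum>j=1..4. c j * fser n j (1 / \<alpha>)) = 0"
  obtain q g where q: "ev q \<alpha> \<noteq> 0" and g: "\<And>i. i \<in> {0..4} \<Longrightarrow> c i * ev q \<alpha> = ev (g i) \<alpha>"
    using Q_adjoin_common_denominator[of "{0..4}" c \<alpha>] c by auto
  have "ev (g 0) \<alpha> + (\<Sum>j=1..4. ev (g j) \<alpha> * fser n j (1 / \<alpha>))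
      = ev q \<alpha> * (c 0 + (\<Sum>j=1..4. c j * fser n j (1 / \<alpha>)))"
    by (simp add: g[symmetric] distrib_left sum_distrib_left mult_ac)
  then have rel': "ev (g 0) \<alpha> + (\<Sum>j=1..4. ev (g j) \<alpha> * fser n j (1 / \<alpha>)) = 0" by (simp only: rel mult_zero_right)
  have "{l. n l mod 4 = 1} \<union> {l. n l mod 4 = 3} = UNIV" using good_seq_mod_4[OF assms(1)] by auto
  then have "infinite ({l. n l mod 4 = 1} \<union> {l. n l mod 4 = 3})" by simp
  \<comment> \<open>Either infinite class yields all four coefficients: as \<open>r\<close> runs
    through the residues modulo 4, \<open>ucoef g c r\<close> runs through \<open>g 1\<close> to
    \<open>g 4\<close>.\<close>
  then consider "infinite {l. n l mod 4 = 1}" | "infinite {l. n l mod 4 = 3}" by auto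
  then have "ev (g j) \<alpha> = 0" if j: "j \<in> {1..4}" for j
  proof cases
    case 1
    have "ucoef g 1 (j mod 4) = g j"
      using idx_mod[OF j, of "j mod 4"] by (simp add: ucoef_def)
    then show ?thesis using ucoef_vanishes[OF assms rel' 1, of "j mod 4"] by simp
  next
    case 2
    \<comment> \<open>For the class 3 the index is shifted by 2, so \<open>g j\<close> is met at the
      residue of \<open>j + 2\<close>.\<close>
    have "((j + 2) mod 4 + 2) mod 4 = j mod 4" by presburger
    then have "ucoef g 3 ((j + 2) mod 4) = g j"
      using idx_mod[OF j, of "(j + 2) mod 4 + 2"] by (simp add: ucoef_def del: add_2_eq_Suc')
    then show ?thesis using ucoef_vanishes[OF assms rel' 2, of "(j + 2) mod 4"] by simp
  qed
  then have cj: "c j = 0" if "j \<in> {1..4}" for j using g[of j] q that by auto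
  then have "c 0 = 0" using rel by simp
  then show "\<forall>i\<in>{0..4}. c i = 0" using cj by (metis atLeastAtMost_iff le_0_eq not_less_eq_eq One_nat_def)
qed

end
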